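(* Let $K$ be a field of characteristic zero and let $q\in K^\times$. Let $Q_q(K)$ be the quantum plane and let $Q_q^k(K)=(Q_q(K),*,\alpha_k)$, $k\in K^\times$, be the hom-associative quantum planes. Then $Q_q^k(K)$ is a one-parameter formal hom-associative deformation of $Q_q(K)$.
   Context: **Hom-associative algebras.** A hom-associative algebra over an associative, commutative, unital ring $R$ is a triple $(M,\cdot,\alpha)$ consisting of an $R$-module $M$, a binary operation $\cdot\colon M\times M\to M$ linear over $R$ in both arguments, and an $R$-linear map $\alpha\colon M\to M$ (the twisting map) such that $\alpha(a)\cdot(b\cdot c)=(a\cdot b)\cdot\alpha(c)$ for all $a,b,c\in M$. An associative algebra is regarded as a hom-associative algebra whose twisting map is the identity. **One-parameter formal hom-associative deformation.** For an $R$-module $M$, $M\llbracket t\rrbracket$ denotes the $R\llbracket t\rrbracket$-module of formal power series in the indeterminate $t$ with coefficients in $M$. A one-parameter formal hom-associative deformation of a hom-associative algebra $(M,\cdot_0,\alpha_0)$ over $R$ is a hom-associative algebra $(M\llbracket t\rrbracket,\cdot_t,\alpha_t)$ over $R\llbracket t\rrbracket$, where $\cdot_t=\sum_{i=0}^\infty\cdot_i\,t^i$ and $\alpha_t=\sum_{i=0}^\infty\alpha_it^i$. Here, for each $i\in\mathbb{N}_0$ (the nonnegative integers), $\cdot_i\colon M\times M\to M$ is a binary operation linear over $R$ in both arguments and $\alpha_i\colon M\to M$ is an $R$-linear map, extended homogeneously (that is, coefficientwise in powers of $t$) to a binary operation on $M\llbracket t\rrbracket$ linear over $R\llbracket t\rrbracket$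 in both arguments and to an $R\llbracket t\rrbracket$-linear map on $M\llbracket t\rrbracket$, respectively. **Quantum planes.** $Q_q(K)$ is the free unital associative algebra $K\langle x,y\rangle$ modulo the relation $x\cdot y=q\,y\cdot x$. It is isomorphic to the Ore extension $K[y][x;\sigma,0]$, where $\sigma$ is the $K$-algebra automorphism of $K[y]$ with $\sigma(y)=qy$; it has $K$-basis $\{y^mx^n: m,n\in\mathbb{N}_0\}$. **Hom-associative quantum planes.** For $k\in K^\times$, $\alpha_k$ is the $K$-algebra endomorphism of $K[y]$ with $\alpha_k(y)=ky$, extended homogeneously in $x$, so that $\alpha_k(ay^mx^n)=ak^my^mx^n$ for $a\in K$. With $a*b:=\alpha_k(a\cdot b)$, the triple $Q_q^k(K)=(Q_q(K),*,\alpha_k)$ is a hom-associative algebra. These algebras form a family with parameter $k$, whose member at $k=1$ is $Q_q(K)$ itself; the statement concerns this $k$-family. *)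

theory Defs
  imports "HOL-Algebra.QuotRing" "HOL-Algebra.Module"
begin

section \<open>Hom-associative algebras\<close>

definition linear_op :: "('r, 'x) ring_scheme \<Rightarrow> ('r, 'm, 'y) module_scheme \<Rightarrow> ('m \<Rightarrow> 'm) \<Rightarrow> bool" where
  "linear_op R M f \<longleftrightarrow>
     f \<in> carrier M \<rightarrow> carrier M \<and>
     (\<forall>a\<in>carrier M. \<forall>b\<in>carrier M. f (a \<oplus>\<^bsub>M\<^esub> b) = f a \<oplus>\<^bsub>M\<^esub> f b) \<and>
     (\<forall>r\<in>carrier R. \<forall>a\<in>carrier M. f (r \<odot>\<^bsub>M\<^esub> a) = r \<odot>\<^bsub>M\<^esub> f a)"

definition bilinear_op :: "('r, 'x) ring_scheme \<Rightarrow> ('r, 'm, 'y) module_scheme \<Rightarrow> ('m \<Rightarrow> 'm \<Rightarrow> 'm) \<Rightarrow> bool" where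
  "bilinear_op R M p \<longleftrightarrow>
     (\<forall>a\<in>carrier M. linear_op R M (\<lambda>b. p a b)) \<and>
     (\<forall>b\<in>carrier M. linear_op R M (\<lambda>a. p a b))"

text \<open>
  The binary operation is an explicit parameter \<open>p\<close>: only the module structure of the record \<open>M\<close>
  is used, not its fields \<^const>\<open>mult\<close> and \<^const>\<open>one\<close>.
  The locale \<^locale>\<open>module\<close> includes that \<open>R\<close> is an associative, commutative, unital ring.
\<close>

definition hom_assoc_algebra ::
  "('r, 'x) ring_scheme \<Rightarrow> ('r, 'm, 'y) module_scheme \<Rightarrow> ('m \<Rightarrow> 'm \<Rightarrow> 'm) \<Rightarrow> ('m \<Rightarrow> 'm) \<Rightarrow> bool" where
  "hom_assoc_algebra R M p \<alpha> \<longleftrightarrow>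
     module R M \<and> bilinear_op R M p \<and> linear_op R M \<alpha> \<and>
     (\<forall>a\<in>carrier M. \<forall>b\<in>carrier M. \<forall>c\<in>carrier M. p (\<alpha> a) (p b c) = p (p a b) (\<alpha> c))"


section \<open>Formal power series\<close>

text \<open>A series is its sequence of coefficients.\<close>

definition ps_ring :: "('a, 'x) ring_scheme \<Rightarrow> (nat \<Rightarrow> 'a) ring" where
  "ps_ring R =
     \<lparr>carrier = {f. \<forall>n. f n \<in> carrier R},
      monoid.mult = (\<lambda>f g n. \<Oplus>\<^bsub>R\<^esub>i\<in>{..n}. f i \<otimes>\<^bsub>R\<^esub> g (n - i)),
      one = (\<lambda>n. if n = 0 then \<one>\<^bsub>R\<^esub> else \<zero>\<^bsub>R\<^esub>),
      zero = (\<lambda>n. \<zero>\<^bsub>R\<^esub>),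
      add = (\<lambda>f g n. f n \<oplus>\<^bsub>R\<^esub> g n)\<rparr>"

text \<open>
  The module of series with coefficients in \<open>M\<close> over the ring of series over \<open>R\<close>. The fields
  \<^const>\<open>mult\<close> and \<^const>\<open>one\<close> of this record play no role below.
\<close>

definition ps_module :: "('r, 'm, 'y) module_scheme \<Rightarrow> (nat \<Rightarrow> 'r, nat \<Rightarrow> 'm) module" where
  "ps_module M = ring.extend (ps_ring M)
     (module.fields (\<lambda>r f n. \<Oplus>\<^bsub>M\<^esub>i\<in>{..n}. r i \<odot>\<^bsub>M\<^esub> f (n - i)))"


section \<open>One-parameter formal hom-associative deformations\<close>

text \<open>
  \<open>ext_linear\<close> and \<open>ext_bilinear\<close> are the homogeneous extensions of a map and of a binary operation
  to power series; \<open>series_linear\<close> and \<open>series_bilinear\<close> are the maps given by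
  \<open>\<Sum>i. \<alpha> i t^i\<close> and \<open>\<Sum>i. p i t^i\<close>.
\<close>

definition ext_linear :: "('m \<Rightarrow> 'm) \<Rightarrow> (nat \<Rightarrow> 'm) \<Rightarrow> (nat \<Rightarrow> 'm)" where
  "ext_linear \<phi> f = (\<lambda>n. \<phi> (f n))"

definition ext_bilinear ::
  "('r, 'm, 'y) module_scheme \<Rightarrow> ('m \<Rightarrow> 'm \<Rightarrow> 'm) \<Rightarrow> (nat \<Rightarrow> 'm) \<Rightarrow> (nat \<Rightarrow> 'm) \<Rightarrow> (nat \<Rightarrow> 'm)" where
  "ext_bilinear M p f g = (\<lambda>n. \<Oplus>\<^bsub>M\<^esub>j\<in>{..n}. p (f j) (g (n - j)))"

definition series_linear ::
  "('r, 'm, 'y) module_scheme \<Rightarrow> (nat \<Rightarrow> 'm \<Rightarrow> 'm) \<Rightarrow> (nat \<Rightarrow> 'm) \<Rightarrow> (nat \<Rightarrow> 'm)" where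
  "series_linear M \<alpha> f = (\<lambda>n. \<Oplus>\<^bsub>M\<^esub>i\<in>{..n}. ext_linear (\<alpha> i) f (n - i))"

definition series_bilinear ::
  "('r, 'm, 'y) module_scheme \<Rightarrow> (nat \<Rightarrow> 'm \<Rightarrow> 'm \<Rightarrow> 'm) \<Rightarrow> (nat \<Rightarrow> 'm) \<Rightarrow> (nat \<Rightarrow> 'm) \<Rightarrow> (nat \<Rightarrow> 'm)" where
  "series_bilinear M p f g = (\<lambda>n. \<Oplus>\<^bsub>M\<^esub>i\<in>{..n}. ext_bilinear M (p i) f g (n - i))"

definition formal_hom_assoc_deformation ::
  "('r, 'x) ring_scheme \<Rightarrow> ('r, 'm, 'y) module_scheme \<Rightarrow> ('m \<Rightarrow> 'm \<Rightarrow> 'm) \<Rightarrow> ('m \<Rightarrow> 'm) \<Rightarrow>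
   (nat \<Rightarrow> 'm \<Rightarrow> 'm \<Rightarrow> 'm) \<Rightarrow> (nat \<Rightarrow> 'm \<Rightarrow> 'm) \<Rightarrow> bool" where
  "formal_hom_assoc_deformation R M p\<^sub>0 \<alpha>\<^sub>0 p \<alpha> \<longleftrightarrow>
     hom_assoc_algebra R M p\<^sub>0 \<alpha>\<^sub>0 \<and>
     (\<forall>i. bilinear_op R M (p i)) \<and> (\<forall>i. linear_op R M (\<alpha> i)) \<and>
     (\<forall>a\<in>carrier M. \<forall>b\<in>carrier M. p 0 a b = p\<^sub>0 a b) \<and>
     (\<forall>a\<in>carrier M. \<alpha> 0 a = \<alpha>\<^sub>0 a) \<and>
     hom_assoc_algebra (ps_ring R) (ps_module M) (series_bilinear M p) (series_linear M \<alpha>)"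

text \<open>
  The coefficients \<open>c i \<in> M\<close> form a polynomial in \<open>t\<close> whose value at \<open>t = s\<close> is \<open>v\<close>. Finite support
  is required explicitly because \<^const>\<open>finsum\<close> over an infinite set is zero.
\<close>

definition poly_value ::
  "('r, 'x) ring_scheme \<Rightarrow> ('r, 'm, 'y) module_scheme \<Rightarrow> 'r \<Rightarrow> (nat \<Rightarrow> 'm) \<Rightarrow> 'm \<Rightarrow> bool" where
  "poly_value R M s c v \<longleftrightarrow>
     finite {i. c i \<noteq> \<zero>\<^bsub>M\<^esub>} \<and>
     v = (\<Oplus>\<^bsub>M\<^esub>i\<in>{i. c i \<noteq> \<zero>\<^bsub>M\<^esub>}. (s [^]\<^bsub>R\<^esub> i) \<odot>\<^bsub>M\<^esub> c i)"

text \<open>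
  A family \<open>(M, p k, \<alpha> k)\<close>, \<open>k \<in> S\<close>, is a formal deformation of \<open>(M, p\<^sub>0, \<alpha>\<^sub>0)\<close> when \<open>t = k - k\<^sub>0\<close> is
  taken as the indeterminate: there is one formal deformation of \<open>(M, p\<^sub>0, \<alpha>\<^sub>0)\<close>, with coefficients \<open>p' i\<close>
  and \<open>\<alpha>' i\<close>, such that every \<open>p k\<close> and \<open>\<alpha> k\<close> is obtained from \<open>\<Sum>i. p' i t^i\<close> and \<open>\<Sum>i. \<alpha>' i t^i\<close>
  by putting \<open>t = k - k\<^sub>0\<close>. For \<open>k\<^sub>0 \<in> S\<close> the case \<open>t = 0\<close> makes \<open>(M, p\<^sub>0, \<alpha>\<^sub>0)\<close> the member at \<open>k\<^sub>0\<close>.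
\<close>

definition family_is_formal_deformation ::
  "('r, 'x) ring_scheme \<Rightarrow> ('r, 'm, 'y) module_scheme \<Rightarrow> 'r set \<Rightarrow> 'r \<Rightarrow>
   ('r \<Rightarrow> 'm \<Rightarrow> 'm \<Rightarrow> 'm) \<Rightarrow> ('r \<Rightarrow> 'm \<Rightarrow> 'm) \<Rightarrow> ('m \<Rightarrow> 'm \<Rightarrow> 'm) \<Rightarrow> ('m \<Rightarrow> 'm) \<Rightarrow> bool" where
  "family_is_formal_deformation R M S k\<^sub>0 p \<alpha> p\<^sub>0 \<alpha>\<^sub>0 \<longleftrightarrow>
     (\<exists>p' \<alpha>'. formal_hom_assoc_deformation R M p\<^sub>0 \<alpha>\<^sub>0 p' \<alpha>' \<and>
       (\<forall>k\<in>S. \<forall>a\<in>carrier M. \<forall>b\<in>carrier M.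
          poly_value R M (k \<ominus>\<^bsub>R\<^esub> k\<^sub>0) (\<lambda>i. p' i a b) (p k a b)) \<and>
       (\<forall>k\<in>S. \<forall>a\<in>carrier M.
          poly_value R M (k \<ominus>\<^bsub>R\<^esub> k\<^sub>0) (\<lambda>i. \<alpha>' i a) (\<alpha> k a)))"


section \<open>Quantum planes\<close>

text \<open>
  The free unital associative algebra on a set of letters: finitely supported functions on words,
  multiplied by convolution along concatenation of words.
\<close>

definition free_algebra :: "('a, 'x) ring_scheme \<Rightarrow> ('a, 'v list \<Rightarrow> 'a) module" where
  "free_algebra R =
     \<lparr>carrier = {f. (\<forall>w. f w \<in> carrier R) \<and> finite {w. f w \<noteq> \<zero>\<^bsub>R\<^esub>}},
      monoid.mult = (\<lambda>f g w. \<Oplus>\<^bsub>R\<^esub>i\<in>{..length w}. f (take i w) \<otimes>\<^bsub>R\<^esub> g (drop i w)),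
      one = (\<lambda>w. if w = [] then \<one>\<^bsub>R\<^esub> else \<zero>\<^bsub>R\<^esub>),
      zero = (\<lambda>w. \<zero>\<^bsub>R\<^esub>),
      add = (\<lambda>f g w. f w \<oplus>\<^bsub>R\<^esub> g w),
      smult = (\<lambda>r f w. r \<otimes>\<^bsub>R\<^esub> f w)\<rparr>"

definition free_gen :: "('a, 'x) ring_scheme \<Rightarrow> 'v \<Rightarrow> 'v list \<Rightarrow> 'a" where
  "free_gen R v = (\<lambda>w. if w = [v] then \<one>\<^bsub>R\<^esub> else \<zero>\<^bsub>R\<^esub>)"

text \<open>
  The quotient by a two-sided ideal \<open>I\<close>, as an algebra. For a coset \<open>C\<close> and \<open>f \<in> C\<close>, the union below
  is the coset of \<open>r f\<close>.
\<close>

definition quotient_algebra ::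
  "('r, 'm, 'y) module_scheme \<Rightarrow> 'm set \<Rightarrow> ('r, 'm set) module" where
  "quotient_algebra A I = ring.extend (A Quot I)
     (module.fields (\<lambda>r C. \<Union>f\<in>C. I +>\<^bsub>A\<^esub> (r \<odot>\<^bsub>A\<^esub> f)))"

datatype letter = X | Y

definition qplane_ideal :: "('a, 'x) ring_scheme \<Rightarrow> 'a \<Rightarrow> (letter list \<Rightarrow> 'a) set" where
  "qplane_ideal K q =
     (let F = free_algebra K; x = free_gen K X; y = free_gen K Y
      in Idl\<^bsub>F\<^esub> {(x \<otimes>\<^bsub>F\<^esub> y) \<ominus>\<^bsub>F\<^esub> (q \<odot>\<^bsub>F\<^esub> (y \<otimes>\<^bsub>F\<^esub> x))})"

definition qplane :: "('a, 'x) ring_scheme \<Rightarrow> 'a \<Rightarrow> ('a, (letter list \<Rightarrow> 'a) set) module" where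
  "qplane K q = quotient_algebra (free_algebra K) (qplane_ideal K q)"

definition qplane_gen :: "('a, 'x) ring_scheme \<Rightarrow> 'a \<Rightarrow> letter \<Rightarrow> (letter list \<Rightarrow> 'a) set" where
  "qplane_gen K q v = qplane_ideal K q +>\<^bsub>free_algebra K\<^esub> free_gen K v"

definition qplane_monom :: "('a, 'x) ring_scheme \<Rightarrow> 'a \<Rightarrow> nat \<Rightarrow> nat \<Rightarrow> (letter list \<Rightarrow> 'a) set" where
  "qplane_monom K q m n =
     (qplane_gen K q Y [^]\<^bsub>qplane K q\<^esub> m) \<otimes>\<^bsub>qplane K q\<^esub> (qplane_gen K q X [^]\<^bsub>qplane K q\<^esub> n)"

text \<open>
  The linear map \<open>y^m x^n \<mapsto> k^m y^m x^n\<close>. It is unique because the monomials \<open>y^m x^n\<close> span;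
  extensionality only fixes the irrelevant values outside the carrier.
\<close>

definition qplane_twist ::
  "('a, 'x) ring_scheme \<Rightarrow> 'a \<Rightarrow> 'a \<Rightarrow> (letter list \<Rightarrow> 'a) set \<Rightarrow> (letter list \<Rightarrow> 'a) set" where
  "qplane_twist K q k = (THE f.
     f \<in> extensional (carrier (qplane K q)) \<and> linear_op K (qplane K q) f \<and>
     (\<forall>m n. f (qplane_monom K q m n) = (k [^]\<^bsub>K\<^esub> m) \<odot>\<^bsub>qplane K q\<^esub> qplane_monom K q m n))"

definition qplane_hom_mult ::
  "('a, 'x) ring_scheme \<Rightarrow> 'a \<Rightarrow> 'a \<Rightarrow>
   (letter list \<Rightarrow> 'a) set \<Rightarrow> (letter list \<Rightarrow> 'a) set \<Rightarrow> (letter list \<Rightarrow> 'a) set" where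
  "qplane_hom_mult K q k a b = qplane_twist K q k (a \<otimes>\<^bsub>qplane K q\<^esub> b)"

end

theory Submission
  imports Defs
begin

text \<open>
  Put \<open>k = 1 + t\<close>. By the binomial theorem the twist \<open>y^m x^n \<mapsto> k^m y^m x^n\<close> is \<open>\<Sum>i. D i t^i\<close> with
  \<open>D i (y^m x^n) = (m choose i) y^m x^n\<close>, a finite sum on each element. By Vandermonde's identity the
  maps \<open>D i\<close> form a higher derivation, \<open>D n (a b) = \<Sum>i\<le>n. D i a D (n - i) b\<close>, so \<open>\<Sum>i. D i t^i\<close> is an
  algebra endomorphism of the power series over the quantum plane. Twisting an associative product
  by an endomorphism gives a hom-associative one (Yau's twisting principle).

  Since the defining relation is homogeneous in \<open>y\<close>, a map of the free algebra that scales each word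
  by a function of the number of its letters \<open>y\<close> descends to the quantum plane; the twist and all \<open>D i\<close>
  arise in this way, which avoids proving that the monomials \<open>y^m x^n\<close> are linearly independent.
\<close>


section \<open>Finite sums\<close>

context abelian_monoid
begin

text \<open>Both sides run over all triples i + j + l = n, grouped on the left by i and on the right
  by k = i + j. This regrouping is behind every associativity law below: for Cauchy products, for
  scalar series and for concatenation of words.\<close>

lemma finsum_atMost_assoc:
  fixes n :: nat
  assumes "\<And>i j l. g i j l \<in> carrier G"
  shows "(\<Oplus>i\<in>{..n}. \<Oplus>j\<in>{..n-i}. g i j (n - i - j)) =
    (\<Oplus>k\<in>{..n}. \<Oplus>i\<in>{..k}. g i (k - i) (n - k))"
  using assms
proof (induction n arbitrary: g)
  case 0
  then show ?case by simp
next
  case (Suc n)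
  note [simp] = Suc.prems
  \<comment> \<open>The term split off is j = n + 1 - i, where the last index is 0. In the other
    terms the last index is a successor, so the induction hypothesis applies to
    \<open>\<lambda>i j l. g i j (Suc l)\<close>.\<close>
  have "(\<Oplus>j\<in>{..Suc n-i}. g i j (Suc n - i - j)) =
      (\<Oplus>j\<in>{..n-i}. g i j (Suc (n - i - j))) \<oplus> g i (Suc n - i) 0" if "i \<le> n" for i
  proof -
    have "(\<Oplus>j\<in>{..n-i}. g i j (Suc (n - i) - j)) = (\<Oplus>j\<in>{..n-i}. g i j (Suc (n - i - j)))"
      by (rule finsum_cong') (auto simp: Suc_diff_le)
    with that show ?thesis by (simp add: Suc_diff_le a_comm)
  qed
  then have "(\<Oplus>i\<in>{..Suc n}. \<Oplus>j\<in>{..Suc n-i}. g i j (Suc n - i - j)) =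
      g (Suc n) 0 0 \<oplus> (\<Oplus>i\<in>{..n}. (\<Oplus>j\<in>{..n-i}. g i j (Suc (n - i - j))) \<oplus> g i (Suc n - i) 0)"
    by (simp cong: finsum_cong)
  also have "\<dots> = g (Suc n) 0 0 \<oplus> ((\<Oplus>i\<in>{..n}. \<Oplus>j\<in>{..n-i}. g i j (Suc (n - i - j))) \<oplus>
      (\<Oplus>i\<in>{..n}. g i (Suc n - i) 0))"
    by (subst finsum_addf) auto
  also have "(\<Oplus>i\<in>{..n}. \<Oplus>j\<in>{..n-i}. g i j (Suc (n - i - j))) =
      (\<Oplus>k\<in>{..n}. \<Oplus>i\<in>{..k}. g i (k - i) (Suc (n - k)))"
    by (rule Suc.IH) simp
  also have "\<dots> = (\<Oplus>k\<in>{..n}. \<Oplus>i\<in>{..k}. g i (k - i) (Suc n - k))"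
    by (rule finsum_cong') (auto simp: Suc_diff_le)
  finally show ?case by (simp add: a_ac)
qed

text \<open>The reflection i -> n - i is an involution of the index set. The summand takes both
  indices so that no n - (n - i) is left after reflecting.\<close>

lemma finsum_atMost_rev:
  fixes n :: nat
  assumes "\<And>i j. f i j \<in> carrier G"
  shows "(\<Oplus>i\<in>{..n}. f i (n - i)) = (\<Oplus>i\<in>{..n}. f (n - i) i)"
proof -
  have inj: "inj_on (\<lambda>i. n - i) {..n}" by (rule inj_onI) auto
  have "(\<lambda>i. n - i) ` {..n} = {..n}"
  proof (intro equalityI subsetI)
    fix i assume "i \<in> {..n}"
    then have "i = n - (n - i)" "n - i \<in> {..n}" by auto
    then show "i \<in> (\<lambda>i. n - i) ` {..n}" by blast
  qed auto
  then have "(\<Oplus>i\<in>{..n}. f i (n - i)) = (\<Oplus>i\<in>{..n}. f (n - i) (n - (n - i)))"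
    using finsum_reindex[of "\<lambda>i. f i (n - i)" "\<lambda>i. n - i" "{..n}"] inj assms by simp
  also have "\<dots> = (\<Oplus>i\<in>{..n}. f (n - i) i)"
    using assms by (intro finsum_cong') auto
  finally show ?thesis .
qed

text \<open>Group by k = i + j, reverse the inner sum, and ungroup. It lets the coefficients of a
  scalar series pass a factor or a linear map.\<close>

lemma finsum_atMost_swap:
  fixes n :: nat
  assumes g: "\<And>i j l. g i j l \<in> carrier G"
  shows "(\<Oplus>i\<in>{..n}. \<Oplus>j\<in>{..n-i}. g i j (n - i - j)) =
    (\<Oplus>j\<in>{..n}. \<Oplus>i\<in>{..n-j}. g i j (n - j - i))"
proof -
  have "(\<Oplus>i\<in>{..n}. \<Oplus>j\<in>{..n-i}. g i j (n - i - j)) =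
      (\<Oplus>k\<in>{..n}. \<Oplus>i\<in>{..k}. g i (k - i) (n - k))"
    by (rule finsum_atMost_assoc[OF g])
  also have "\<dots> = (\<Oplus>k\<in>{..n}. \<Oplus>i\<in>{..k}. g (k - i) i (n - k))"
    using g finsum_atMost_rev[of "\<lambda>i j. g i j (n - k)" for k] by simp
  also have "\<dots> = (\<Oplus>j\<in>{..n}. \<Oplus>i\<in>{..n-j}. g i j (n - j - i))"
    by (rule finsum_atMost_assoc[of "\<lambda>j i. g i j", symmetric]) (rule g)
  finally show ?thesis .
qed

lemma finsum_swap:
  assumes "finite A" "finite B" "\<And>x y. x \<in> A \<Longrightarrow> y \<in> B \<Longrightarrow> g x y \<in> carrier G"
  shows "(\<Oplus>x\<in>A. \<Oplus>y\<in>B. g x y) = (\<Oplus>y\<in>B. \<Oplus>x\<in>A. g x y)"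
  using assms(1,3)
proof (induction A rule: finite_induct)
  case (insert a A)
  have "(\<Oplus>x\<in>insert a A. \<Oplus>y\<in>B. g x y) = (\<Oplus>y\<in>B. g a y) \<oplus> (\<Oplus>y\<in>B. \<Oplus>x\<in>A. g x y)"
    using insert by (subst finsum_insert) (auto intro!: finsum_closed)
  also have "\<dots> = (\<Oplus>y\<in>B. g a y \<oplus> (\<Oplus>x\<in>A. g x y))"
    using insert by (intro finsum_addf[symmetric]) (auto intro!: finsum_closed)
  also have "\<dots> = (\<Oplus>y\<in>B. \<Oplus>x\<in>insert a A. g x y)"
    using insert by (intro finsum_cong') (auto intro!: finsum_closed)
  finally show ?case .
qed (use assms(2) in simp)

end

section \<open>Additive and linear maps applied to finite sums\<close>

lemma finsum_additive:
  assumes "abelian_monoid M" "abelian_group N" and h: "h \<in> carrier M \<rightarrow> carrier N"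
    and add: "\<And>a b. a \<in> carrier M \<Longrightarrow> b \<in> carrier M \<Longrightarrow> h (a \<oplus>\<^bsub>M\<^esub> b) = h a \<oplus>\<^bsub>N\<^esub> h b"
    and "f \<in> A \<rightarrow> carrier M"
  shows "h (\<Oplus>\<^bsub>M\<^esub>i\<in>A. f i) = (\<Oplus>\<^bsub>N\<^esub>i\<in>A. h (f i))"
proof -
  interpret M: abelian_monoid M by fact
  interpret N: abelian_group N by fact
  have h0: "h \<zero>\<^bsub>M\<^esub> = \<zero>\<^bsub>N\<^esub>"
    using funcset_mem[OF h M.zero_closed] add[of "\<zero>\<^bsub>M\<^esub>" "\<zero>\<^bsub>M\<^esub>"]
    by (metis M.l_zero M.zero_closed N.add.r_cancel_one')
  show ?thesis
  proof (cases "finite A")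
    case True
    then show ?thesis using \<open>f \<in> A \<rightarrow> carrier M\<close>
    proof (induction A rule: finite_induct)
      case (insert a A)
      have "h (\<Oplus>\<^bsub>M\<^esub>i\<in>insert a A. f i) = h (f a \<oplus>\<^bsub>M\<^esub> (\<Oplus>\<^bsub>M\<^esub>i\<in>A. f i))"
        using insert by (subst M.finsum_insert) auto
      also have "\<dots> = h (f a) \<oplus>\<^bsub>N\<^esub> h (\<Oplus>\<^bsub>M\<^esub>i\<in>A. f i)"
        using insert by (intro add) (auto intro!: M.finsum_closed)
      also have "\<dots> = (\<Oplus>\<^bsub>N\<^esub>i\<in>insert a A. h (f i))"
        using insert h by (subst N.finsum_insert) auto
      finally show ?case .
    qed (simp add: h0)
  qed (simp add: h0)
qed

lemma linear_op_closed: "linear_op R M f \<Longrightarrow> a \<in> carrier M \<Longrightarrow> f a \<in> carrier M"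
  by (auto simp: linear_op_def)

lemma linear_op_add:
  "linear_op R M f \<Longrightarrow> a \<in> carrier M \<Longrightarrow> b \<in> carrier M \<Longrightarrow> f (a \<oplus>\<^bsub>M\<^esub> b) = f a \<oplus>\<^bsub>M\<^esub> f b"
  by (auto simp: linear_op_def)

lemma linear_op_smult:
  "linear_op R M f \<Longrightarrow> r \<in> carrier R \<Longrightarrow> a \<in> carrier M \<Longrightarrow> f (r \<odot>\<^bsub>M\<^esub> a) = r \<odot>\<^bsub>M\<^esub> f a"
  by (auto simp: linear_op_def)

lemma linear_op_finsum:
  assumes "abelian_group M" "linear_op R M h" "f \<in> A \<rightarrow> carrier M"
  shows "h (\<Oplus>\<^bsub>M\<^esub>i\<in>A. f i) = (\<Oplus>\<^bsub>M\<^esub>i\<in>A. h (f i))"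
  using assms by (intro finsum_additive) (auto simp: linear_op_def abelian_group.axioms)

lemma (in module) finsum_smult_rdistr:
  assumes "f \<in> A \<rightarrow> carrier R" "x \<in> carrier M"
  shows "(\<Oplus>\<^bsub>R\<^esub>i\<in>A. f i) \<odot>\<^bsub>M\<^esub> x = (\<Oplus>\<^bsub>M\<^esub>i\<in>A. f i \<odot>\<^bsub>M\<^esub> x)"
  using assms
  by (intro finsum_additive[where h = "\<lambda>r. r \<odot>\<^bsub>M\<^esub> x"])
    (auto simp: smult_l_distr M.abelian_group_axioms R.abelian_monoid_axioms)


section \<open>Algebras\<close>

text \<open>M need not be commutative, so neither of the two compatibility laws gives the
  other.\<close>

locale assoc_algebra = module R M + A?: ring M for R (structure) and M (structure) +
  assumes smult_mult_left:
      "\<lbrakk>r \<in> carrier R; a \<in> carrier M; b \<in> carrier M\<rbrakk> \<Longrightarrow> (r \<odot>\<^bsub>M\<^esub> a) \<otimes>\<^bsub>M\<^esub> b = r \<odot>\<^bsub>M\<^esub> (a \<otimes>\<^bsub>M\<^esub> b)"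
    and smult_mult_right:
      "\<lbrakk>r \<in> carrier R; a \<in> carrier M; b \<in> carrier M\<rbrakk> \<Longrightarrow> a \<otimes>\<^bsub>M\<^esub> (r \<odot>\<^bsub>M\<^esub> b) = r \<odot>\<^bsub>M\<^esub> (a \<otimes>\<^bsub>M\<^esub> b)"

text \<open>Only values on the carrier enter, since the carrier is closed under p. This allows
  \<open>series_bilinear\<close> to replace a twisted Cauchy product with which it is shown to agree
  on the carrier.\<close>

lemma hom_assoc_algebra_cong:
  assumes "hom_assoc_algebra R M p \<alpha>"
    and "\<And>a b. a \<in> carrier M \<Longrightarrow> b \<in> carrier M \<Longrightarrow> p' a b = p a b"
  shows "hom_assoc_algebra R M p' \<alpha>"
proof -
  interpret module R M using assms(1) by (simp add: hom_assoc_algebra_def)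
  have "p a b \<in> carrier M" "\<alpha> a \<in> carrier M" if "a \<in> carrier M" "b \<in> carrier M" for a b
    using assms(1) that by (auto simp: hom_assoc_algebra_def bilinear_op_def linear_op_def)
  with assms show ?thesis
    by (simp add: hom_assoc_algebra_def bilinear_op_def linear_op_def Pi_iff)
qed

context assoc_algebra
begin

lemma bilinear_op_linear_mult:
  assumes "linear_op R M h"
  shows "bilinear_op R M (\<lambda>a b. h (a \<otimes>\<^bsub>M\<^esub> b))"
  using assms
  by (auto simp: bilinear_op_def linear_op_def A.l_distr A.r_distr smult_mult_left smult_mult_right)

text \<open>Pushing h inward by multiplicativity turns both sides of hom-associativity into products
  of h (h a), h (h b) and h (h c) that differ only in the bracketing.\<close>

lemma hom_assoc_algebra_twist:
  assumes h: "linear_op R M h"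
    and mult: "\<And>a b. a \<in> carrier M \<Longrightarrow> b \<in> carrier M \<Longrightarrow> h (a \<otimes>\<^bsub>M\<^esub> b) = h a \<otimes>\<^bsub>M\<^esub> h b"
  shows "hom_assoc_algebra R M (\<lambda>a b. h (a \<otimes>\<^bsub>M\<^esub> b)) h"
  using h bilinear_op_linear_mult[OF h] linear_op_closed[OF h]
  by (simp add: hom_assoc_algebra_def module_axioms mult A.m_assoc)

end


section \<open>Formal power series\<close>

lemma ps_ring_simps:
  "carrier (ps_ring R) = {f. \<forall>n. f n \<in> carrier R}"
  "f \<otimes>\<^bsub>ps_ring R\<^esub> g = (\<lambda>n. \<Oplus>\<^bsub>R\<^esub>i\<in>{..n}. f i \<otimes>\<^bsub>R\<^esub> g (n - i))"
  "\<one>\<^bsub>ps_ring R\<^esub> = (\<lambda>n. if n = 0 then \<one>\<^bsub>R\<^esub> else \<zero>\<^bsub>R\<^esub>)"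
  "\<zero>\<^bsub>ps_ring R\<^esub> = (\<lambda>n. \<zero>\<^bsub>R\<^esub>)"
  "f \<oplus>\<^bsub>ps_ring R\<^esub> g = (\<lambda>n. f n \<oplus>\<^bsub>R\<^esub> g n)"
  by (simp_all add: ps_ring_def)

lemma ps_module_simps:
  "carrier (ps_module M) = {f. \<forall>n. f n \<in> carrier M}"
  "f \<otimes>\<^bsub>ps_module M\<^esub> g = (\<lambda>n. \<Oplus>\<^bsub>M\<^esub>i\<in>{..n}. f i \<otimes>\<^bsub>M\<^esub> g (n - i))"
  "\<one>\<^bsub>ps_module M\<^esub> = (\<lambda>n. if n = 0 then \<one>\<^bsub>M\<^esub> else \<zero>\<^bsub>M\<^esub>)"
  "\<zero>\<^bsub>ps_module M\<^esub> = (\<lambda>n. \<zero>\<^bsub>M\<^esub>)"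
  "f \<oplus>\<^bsub>ps_module M\<^esub> g = (\<lambda>n. f n \<oplus>\<^bsub>M\<^esub> g n)"
  "r \<odot>\<^bsub>ps_module M\<^esub> f = (\<lambda>n. \<Oplus>\<^bsub>M\<^esub>i\<in>{..n}. r i \<odot>\<^bsub>M\<^esub> f (n - i))"
  by (simp_all add: ps_module_def ps_ring_def ring.defs module.defs)

text \<open>The ring laws involve only fields that the extension keeps. This covers
  \<open>ps_module\<close> and \<open>quotient_algebra\<close>, which both extend a ring record by a
  scalar multiplication.\<close>

lemma ring_extend:
  assumes "ring A"
  shows "ring (ring.extend A x)"
proof -
  interpret A: ring A by fact
  have ag: "abelian_group (ring.extend A x)"
    by (rule abelian_groupI) (auto simp: ring.defs A.a_ac intro: A.l_neg)
  show ?thesis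
    by (rule ringI[OF ag monoidI]) (auto simp: ring.defs A.m_assoc A.l_distr A.r_distr)
qed

context abelian_monoid
begin

lemma finsum_atMost_single_left:
  fixes n :: nat
  assumes "f 0 \<in> carrier G" "\<And>i. 0 < i \<Longrightarrow> i \<le> n \<Longrightarrow> f i = \<zero>"
  shows "(\<Oplus>i\<in>{..n}. f i) = f 0"
proof -
  have "f i \<in> carrier G" if "i \<le> n" for i
    using assms that by (cases i) auto
  note c = this
  have "(\<Oplus>i\<in>{..n}. f i) = (\<Oplus>i\<in>{..n}. if 0 = i then f i else \<zero>)"
    using assms c by (intro finsum_cong') auto
  also have "\<dots> = f 0"
    using c by (subst finsum_singleton) auto
  finally show ?thesis .
qed

end

lemma (in ring) ring_ps_ring: "ring (ps_ring R)"
proof (rule ringI)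
  show "abelian_group (ps_ring R)"
  proof (rule abelian_groupI)
    fix f assume "f \<in> carrier (ps_ring R)"
    then show "\<exists>g\<in>carrier (ps_ring R). g \<oplus>\<^bsub>ps_ring R\<^esub> f = \<zero>\<^bsub>ps_ring R\<^esub>"
      by (intro bexI[of _ "\<lambda>n. \<ominus> f n"]) (auto simp: ps_ring_simps l_neg)
  qed (auto simp: ps_ring_simps a_ac)
  show "Group.monoid (ps_ring R)"
  proof (rule monoidI)
    fix f g h
    assume "f \<in> carrier (ps_ring R)" "g \<in> carrier (ps_ring R)" "h \<in> carrier (ps_ring R)"
    then have [simp]: "f i \<in> carrier R" "g i \<in> carrier R" "h i \<in> carrier R" for i
      by (auto simp: ps_ring_simps)
    have "(\<Oplus>k\<in>{..n}. (\<Oplus>i\<in>{..k}. f i \<otimes> g (k - i)) \<otimes> h (n - k)) =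
        (\<Oplus>i\<in>{..n}. f i \<otimes> (\<Oplus>j\<in>{..n - i}. g j \<otimes> h (n - i - j)))" for n
      \<comment> \<open>Both sides sum f i g j h l over i + j + l = n.\<close>
      using finsum_atMost_assoc[of "\<lambda>i j l. f i \<otimes> (g j \<otimes> h l)" n]
      by (simp add: finsum_ldistr finsum_rdistr Pi_iff m_assoc)
    then show "(f \<otimes>\<^bsub>ps_ring R\<^esub> g) \<otimes>\<^bsub>ps_ring R\<^esub> h = f \<otimes>\<^bsub>ps_ring R\<^esub> (g \<otimes>\<^bsub>ps_ring R\<^esub> h)"
      by (simp add: ps_ring_simps)
  next
    fix f assume "f \<in> carrier (ps_ring R)"
    then have f [simp]: "f i \<in> carrier R" for i by (auto simp: ps_ring_simps)
    show "\<one>\<^bsub>ps_ring R\<^esub> \<otimes>\<^bsub>ps_ring R\<^esub> f = f"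
      by (rule ext) (simp add: ps_ring_simps finsum_atMost_single_left)
    show "f \<otimes>\<^bsub>ps_ring R\<^esub> \<one>\<^bsub>ps_ring R\<^esub> = f"
    proof
      fix n
      \<comment> \<open>The only term that survives stands at i = n; the reversal moves it to index
        0.\<close>
      have "(f \<otimes>\<^bsub>ps_ring R\<^esub> \<one>\<^bsub>ps_ring R\<^esub>) n = (\<Oplus>i\<in>{..n}. f (n - i) \<otimes> \<one>\<^bsub>ps_ring R\<^esub> i)"
        using finsum_atMost_rev[of "\<lambda>i j. f i \<otimes> \<one>\<^bsub>ps_ring R\<^esub> j" n] by (simp add: ps_ring_simps)
      also have "\<dots> = f n"
        by (simp add: ps_ring_simps finsum_atMost_single_left)
      finally show "(f \<otimes>\<^bsub>ps_ring R\<^esub> \<one>\<^bsub>ps_ring R\<^esub>) n = f n" .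
    qed
  qed (auto simp: ps_ring_simps)
qed (auto simp: ps_ring_simps l_distr r_distr finsum_addf Pi_iff)

lemma (in cring) cring_ps_ring: "cring (ps_ring R)"
proof (intro cring.intro comm_monoid.intro comm_monoid_axioms.intro)
  show "ring (ps_ring R)" by (rule ring_ps_ring)
  then show "Group.monoid (ps_ring R)" by (rule ring.axioms)
  fix f g assume "f \<in> carrier (ps_ring R)" "g \<in> carrier (ps_ring R)"
  then have [simp]: "f i \<in> carrier R" "g i \<in> carrier R" for i
    by (auto simp: ps_ring_simps)
  show "f \<otimes>\<^bsub>ps_ring R\<^esub> g = g \<otimes>\<^bsub>ps_ring R\<^esub> f"
    using finsum_atMost_rev[of "\<lambda>i j. f i \<otimes> g j"] by (simp add: ps_ring_simps m_comm)
qed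

context assoc_algebra
begin

text \<open>The series carry the Cauchy product of M, so that they form an associative algebra over
  R[[t]] which can itself be twisted. The laws with nested products are regroupings of sums over i +
  j + l = n.\<close>

lemma assoc_algebra_ps_module: "assoc_algebra (ps_ring R) (ps_module M)"
proof -
  have ring: "ring (ps_module M)"
    unfolding ps_module_def by (intro ring_extend A.ring_ps_ring)
  have "module (ps_ring R) (ps_module M)"
  proof (rule moduleI)
    show "cring (ps_ring R)" by (rule cring_ps_ring)
    show "abelian_group (ps_module M)" using ring by (rule ring.axioms)
    fix r s f
    assume "r \<in> carrier (ps_ring R)" "s \<in> carrier (ps_ring R)" "f \<in> carrier (ps_module M)"
    then have [simp]: "r i \<in> carrier R" "s i \<in> carrier R" "f i \<in> carrier M" for i
      by (auto simp: ps_ring_simps ps_module_simps)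
    have "(\<Oplus>\<^bsub>M\<^esub>k\<in>{..n}. (\<Oplus>\<^bsub>R\<^esub>i\<in>{..k}. r i \<otimes> s (k - i)) \<odot>\<^bsub>M\<^esub> f (n - k)) =
        (\<Oplus>\<^bsub>M\<^esub>i\<in>{..n}. r i \<odot>\<^bsub>M\<^esub> (\<Oplus>\<^bsub>M\<^esub>j\<in>{..n - i}. s j \<odot>\<^bsub>M\<^esub> f (n - i - j)))" for n
      using M.finsum_atMost_assoc[of "\<lambda>i j l. r i \<odot>\<^bsub>M\<^esub> (s j \<odot>\<^bsub>M\<^esub> f l)" n]
      by (simp add: finsum_smult_ldistr finsum_smult_rdistr Pi_iff smult_assoc1)
    then show "(r \<otimes>\<^bsub>ps_ring R\<^esub> s) \<odot>\<^bsub>ps_module M\<^esub> f = r \<odot>\<^bsub>ps_module M\<^esub> (s \<odot>\<^bsub>ps_module M\<^esub> f)"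
      by (simp add: ps_module_simps ps_ring_simps)
  next
    fix f assume "f \<in> carrier (ps_module M)"
    then have f [simp]: "f i \<in> carrier M" for i by (auto simp: ps_module_simps)
    show "\<one>\<^bsub>ps_ring R\<^esub> \<odot>\<^bsub>ps_module M\<^esub> f = f"
      by (rule ext) (simp add: ps_ring_simps ps_module_simps M.finsum_atMost_single_left)
  qed (simp_all add: ps_ring_simps ps_module_simps smult_l_distr smult_r_distr Pi_iff)
  moreover have "assoc_algebra_axioms (ps_ring R) (ps_module M)"
  proof
    fix r f g
    assume "r \<in> carrier (ps_ring R)" "f \<in> carrier (ps_module M)" "g \<in> carrier (ps_module M)"
    then have [simp]: "r i \<in> carrier R" "f i \<in> carrier M" "g i \<in> carrier M" for i
      by (auto simp: ps_ring_simps ps_module_simps)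
    have left: "(\<Oplus>\<^bsub>M\<^esub>k\<in>{..n}. (\<Oplus>\<^bsub>M\<^esub>i\<in>{..k}. r i \<odot>\<^bsub>M\<^esub> f (k - i)) \<otimes>\<^bsub>M\<^esub> g (n - k)) =
        (\<Oplus>\<^bsub>M\<^esub>i\<in>{..n}. r i \<odot>\<^bsub>M\<^esub> (\<Oplus>\<^bsub>M\<^esub>j\<in>{..n - i}. f j \<otimes>\<^bsub>M\<^esub> g (n - i - j)))" for n
      using M.finsum_atMost_assoc[of "\<lambda>i j l. r i \<odot>\<^bsub>M\<^esub> (f j \<otimes>\<^bsub>M\<^esub> g l)" n]
      by (simp add: A.finsum_ldistr finsum_smult_ldistr Pi_iff smult_mult_left)
    \<comment> \<open>Here the scalar series sits in the inner sum, so the first two indices have to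
      be exchanged.\<close>
    have right: "(\<Oplus>\<^bsub>M\<^esub>i\<in>{..n}. f i \<otimes>\<^bsub>M\<^esub> (\<Oplus>\<^bsub>M\<^esub>j\<in>{..n - i}. r j \<odot>\<^bsub>M\<^esub> g (n - i - j))) =
        (\<Oplus>\<^bsub>M\<^esub>i\<in>{..n}. r i \<odot>\<^bsub>M\<^esub> (\<Oplus>\<^bsub>M\<^esub>j\<in>{..n - i}. f j \<otimes>\<^bsub>M\<^esub> g (n - i - j)))" for n
      using M.finsum_atMost_swap[of "\<lambda>i j l. r i \<odot>\<^bsub>M\<^esub> (f j \<otimes>\<^bsub>M\<^esub> g l)" n]
      by (simp add: A.finsum_rdistr finsum_smult_ldistr Pi_iff smult_mult_right)
    show "r \<odot>\<^bsub>ps_module M\<^esub> f \<otimes>\<^bsub>ps_module M\<^esub> g = r \<odot>\<^bsub>ps_module M\<^esub> (f \<otimes>\<^bsub>ps_module M\<^esub> g)"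
      using left by (simp add: ps_module_simps)
    show "f \<otimes>\<^bsub>ps_module M\<^esub> (r \<odot>\<^bsub>ps_module M\<^esub> g) = r \<odot>\<^bsub>ps_module M\<^esub> (f \<otimes>\<^bsub>ps_module M\<^esub> g)"
      using right by (simp add: ps_module_simps)
  qed
  ultimately show ?thesis using ring by (intro assoc_algebra.intro)
qed

end


section \<open>Formal deformations from higher derivations\<close>

context assoc_algebra
begin

lemma linear_op_series_linear:
  assumes D: "\<And>i. linear_op R M (D i)"
  shows "linear_op (ps_ring R) (ps_module M) (series_linear M D)"
proof -
  note [simp] = linear_op_closed[OF D] linear_op_add[OF D] linear_op_smult[OF D]
  show ?thesis
    unfolding linear_op_def
  proof (intro conjI ballI)
    fix r f assume "r \<in> carrier (ps_ring R)" "f \<in> carrier (ps_module M)"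
    then have [simp]: "r i \<in> carrier R" "f i \<in> carrier M" for i
      by (auto simp: ps_ring_simps ps_module_simps)
    \<comment> \<open>Each D i passes the scalars r j because it is R-linear; what remains is an
      exchange of i and j in a sum over i + j + l = n.\<close>
    have "(\<Oplus>\<^bsub>M\<^esub>i\<in>{..n}. D i (\<Oplus>\<^bsub>M\<^esub>j\<in>{..n - i}. r j \<odot>\<^bsub>M\<^esub> f (n - i - j))) =
        (\<Oplus>\<^bsub>M\<^esub>j\<in>{..n}. r j \<odot>\<^bsub>M\<^esub> (\<Oplus>\<^bsub>M\<^esub>i\<in>{..n - j}. D i (f (n - j - i))))" for n
      using M.finsum_atMost_swap[of "\<lambda>i j l. r j \<odot>\<^bsub>M\<^esub> D i (f l)" n]
      by (simp add: linear_op_finsum[OF M.abelian_group_axioms D] finsum_smult_ldistr Pi_iff)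
    then show "series_linear M D (r \<odot>\<^bsub>ps_module M\<^esub> f) = r \<odot>\<^bsub>ps_module M\<^esub> series_linear M D f"
      by (simp add: series_linear_def ext_linear_def ps_module_simps)
  qed (simp_all add: series_linear_def ext_linear_def ps_module_simps Pi_iff)
qed

text \<open>Both n-th coefficients are the sum of the products of D a (f j) and D b (g l) over a + b
  + j + l = n. The Leibniz rule groups this sum by a + b, the Cauchy product of the images groups it
  by a + j.\<close>

lemma series_linear_mult:
  assumes D: "\<And>i. linear_op R M (D i)"
    and leibniz: "\<And>n a b. a \<in> carrier M \<Longrightarrow> b \<in> carrier M \<Longrightarrow>
      D n (a \<otimes>\<^bsub>M\<^esub> b) = (\<Oplus>\<^bsub>M\<^esub>i\<in>{..n}. D i a \<otimes>\<^bsub>M\<^esub> D (n - i) b)"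
    and "f \<in> carrier (ps_module M)" "g \<in> carrier (ps_module M)"
  shows "series_linear M D (f \<otimes>\<^bsub>ps_module M\<^esub> g) =
    series_linear M D f \<otimes>\<^bsub>ps_module M\<^esub> series_linear M D g"
proof
  fix n
  note [simp] = linear_op_closed[OF D]
  have [simp]: "f i \<in> carrier M" "g i \<in> carrier M" for i
    using assms(3,4) by (auto simp: ps_module_simps)
  define h where "h a b j l = D a (f j) \<otimes>\<^bsub>M\<^esub> D b (g l)" for a b j l
  have [simp]: "h a b j l \<in> carrier M" for a b j l by (simp add: h_def)
  have "series_linear M D (f \<otimes>\<^bsub>ps_module M\<^esub> g) n =
      (\<Oplus>\<^bsub>M\<^esub>i\<in>{..n}. \<Oplus>\<^bsub>M\<^esub>j\<in>{..n - i}. \<Oplus>\<^bsub>M\<^esub>a\<in>{..i}. h a (i - a) j (n - i - j))"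
    by (simp add: series_linear_def ext_linear_def ps_module_simps leibniz h_def
        linear_op_finsum[OF M.abelian_group_axioms D] Pi_iff)
  also have "\<dots> = (\<Oplus>\<^bsub>M\<^esub>p\<in>{..n}. \<Oplus>\<^bsub>M\<^esub>i\<in>{..p}. \<Oplus>\<^bsub>M\<^esub>a\<in>{..i}. h a (i - a) (p - i) (n - p))"
    by (rule M.finsum_atMost_assoc) simp
  \<comment> \<open>For fixed p = a + b + j, and hence fixed l = n - p, the terms are regrouped from
    the pair (a + b, j) to the pair (a + j, b), with k standing for a + j.\<close>
  also have "\<dots> = (\<Oplus>\<^bsub>M\<^esub>p\<in>{..n}. \<Oplus>\<^bsub>M\<^esub>k\<in>{..p}. \<Oplus>\<^bsub>M\<^esub>a\<in>{..k}. h a (p - k) (k - a) (n - p))"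
  proof (rule M.finsum_cong')
    fix p
    have "(\<Oplus>\<^bsub>M\<^esub>i\<in>{..p}. \<Oplus>\<^bsub>M\<^esub>a\<in>{..i}. h a (i - a) (p - i) (n - p)) =
        (\<Oplus>\<^bsub>M\<^esub>a\<in>{..p}. \<Oplus>\<^bsub>M\<^esub>b\<in>{..p - a}. h a b (p - a - b) (n - p))"
      by (rule M.finsum_atMost_assoc[symmetric]) simp
    also have "\<dots> = (\<Oplus>\<^bsub>M\<^esub>a\<in>{..p}. \<Oplus>\<^bsub>M\<^esub>j\<in>{..p - a}. h a (p - a - j) j (n - p))"
      by (intro M.finsum_cong' M.finsum_atMost_rev) (auto simp del: diff_diff_left)
    also have "\<dots> = (\<Oplus>\<^bsub>M\<^esub>k\<in>{..p}. \<Oplus>\<^bsub>M\<^esub>a\<in>{..k}. h a (p - k) (k - a) (n - p))"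
      by (rule M.finsum_atMost_assoc[of "\<lambda>a j b. h a b j (n - p)"]) simp
    finally show "(\<Oplus>\<^bsub>M\<^esub>i\<in>{..p}. \<Oplus>\<^bsub>M\<^esub>a\<in>{..i}. h a (i - a) (p - i) (n - p)) =
        (\<Oplus>\<^bsub>M\<^esub>k\<in>{..p}. \<Oplus>\<^bsub>M\<^esub>a\<in>{..k}. h a (p - k) (k - a) (n - p))" .
  qed auto
  \<comment> \<open>Now p = k + b is split, so that k = a + j belongs to the first factor and b + l
    = n - k to the second.\<close>
  also have "\<dots> = (\<Oplus>\<^bsub>M\<^esub>k\<in>{..n}. \<Oplus>\<^bsub>M\<^esub>b\<in>{..n - k}. \<Oplus>\<^bsub>M\<^esub>a\<in>{..k}. h a b (k - a) (n - k - b))"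
    by (rule M.finsum_atMost_assoc[of "\<lambda>k b l. \<Oplus>\<^bsub>M\<^esub>a\<in>{..k}. h a b (k - a) l", symmetric]) simp
  also have "\<dots> = (series_linear M D f \<otimes>\<^bsub>ps_module M\<^esub> series_linear M D g) n"
    by (simp add: series_linear_def ext_linear_def ps_module_simps h_def
        A.finsum_ldistr A.finsum_rdistr Pi_iff)
  finally show "series_linear M D (f \<otimes>\<^bsub>ps_module M\<^esub> g) n =
      (series_linear M D f \<otimes>\<^bsub>ps_module M\<^esub> series_linear M D g) n" .
qed

text \<open>A higher derivation D sums to an endomorphism of the series over M that is the identity
  modulo t. Twisting the Cauchy product by this endomorphism yields a product whose coefficients are
  a, b -> D i (a b).\<close>

lemma formal_hom_assoc_deformation_higher_derivation:
  assumes D: "\<And>i. linear_op R M (D i)"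
    and D0: "\<And>a. a \<in> carrier M \<Longrightarrow> D 0 a = a"
    and leibniz: "\<And>n a b. a \<in> carrier M \<Longrightarrow> b \<in> carrier M \<Longrightarrow>
      D n (a \<otimes>\<^bsub>M\<^esub> b) = (\<Oplus>\<^bsub>M\<^esub>i\<in>{..n}. D i a \<otimes>\<^bsub>M\<^esub> D (n - i) b)"
  shows "formal_hom_assoc_deformation R M (\<lambda>a b. a \<otimes>\<^bsub>M\<^esub> b) (\<lambda>a. a) (\<lambda>i a b. D i (a \<otimes>\<^bsub>M\<^esub> b)) D"
proof -
  interpret ps: assoc_algebra "ps_ring R" "ps_module M" by (rule assoc_algebra_ps_module)
  have "hom_assoc_algebra R M (\<lambda>a b. a \<otimes>\<^bsub>M\<^esub> b) (\<lambda>a. a)"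
    by (rule hom_assoc_algebra_twist[where h = "\<lambda>a. a"]) (auto simp: linear_op_def)
  moreover have "hom_assoc_algebra (ps_ring R) (ps_module M)
      (series_bilinear M (\<lambda>i a b. D i (a \<otimes>\<^bsub>M\<^esub> b))) (series_linear M D)"
  proof (rule hom_assoc_algebra_cong)
    show "hom_assoc_algebra (ps_ring R) (ps_module M)
        (\<lambda>f g. series_linear M D (f \<otimes>\<^bsub>ps_module M\<^esub> g)) (series_linear M D)"
      using D leibniz
      by (intro ps.hom_assoc_algebra_twist linear_op_series_linear series_linear_mult)
    fix f g assume "f \<in> carrier (ps_module M)" "g \<in> carrier (ps_module M)"
    \<comment> \<open>Since D i is additive, applying it to a coefficient of the Cauchy product
      agrees with the homogeneous extension of a, b -> D i (a b).\<close>
    then show "series_bilinear M (\<lambda>i a b. D i (a \<otimes>\<^bsub>M\<^esub> b)) f g =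
        series_linear M D (f \<otimes>\<^bsub>ps_module M\<^esub> g)"
      by (simp add: series_bilinear_def ext_bilinear_def series_linear_def ext_linear_def
          ps_module_simps linear_op_finsum[OF M.abelian_group_axioms D] Pi_iff)
  qed
  ultimately show ?thesis
    using D D0 bilinear_op_linear_mult
    by (auto simp: formal_hom_assoc_deformation_def)
qed

end


section \<open>The free algebra\<close>

lemma free_algebra_simps:
  "carrier (free_algebra R) = {f. (\<forall>w. f w \<in> carrier R) \<and> finite {w. f w \<noteq> \<zero>\<^bsub>R\<^esub>}}"
  "f \<otimes>\<^bsub>free_algebra R\<^esub> g = (\<lambda>w. \<Oplus>\<^bsub>R\<^esub>i\<in>{..length w}. f (take i w) \<otimes>\<^bsub>R\<^esub> g (drop i w))"
  "\<one>\<^bsub>free_algebra R\<^esub> = (\<lambda>w. if w = [] then \<one>\<^bsub>R\<^esub> else \<zero>\<^bsub>R\<^esub>)"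
  "\<zero>\<^bsub>free_algebra R\<^esub> = (\<lambda>w. \<zero>\<^bsub>R\<^esub>)"
  "f \<oplus>\<^bsub>free_algebra R\<^esub> g = (\<lambda>w. f w \<oplus>\<^bsub>R\<^esub> g w)"
  "r \<odot>\<^bsub>free_algebra R\<^esub> f = (\<lambda>w. r \<otimes>\<^bsub>R\<^esub> f w)"
  by (simp_all add: free_algebra_def)

text \<open>The coefficient is built in, so that sums of these monomials already exhaust the free
  algebra; coefficient zero gives the zero element for every word.\<close>

definition free_monom :: "('a, 'x) ring_scheme \<Rightarrow> 'a \<Rightarrow> 'v list \<Rightarrow> 'v list \<Rightarrow> 'a" where
  "free_monom R a w = (\<lambda>v. if v = w then a else \<zero>\<^bsub>R\<^esub>)"

lemma free_gen_eq_monom: "free_gen R v = free_monom R \<one>\<^bsub>R\<^esub> [v]"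
  by (simp add: free_gen_def free_monom_def)

lemma free_algebra_one_eq_monom: "\<one>\<^bsub>free_algebra R\<^esub> = free_monom R \<one>\<^bsub>R\<^esub> []"
  by (simp add: free_monom_def free_algebra_simps)

context cring
begin

lemma free_algebra_closed: "f \<in> carrier (free_algebra R) \<Longrightarrow> f w \<in> carrier R"
  by (simp add: free_algebra_simps)

lemma free_monom_closed [simp]: "a \<in> carrier R \<Longrightarrow> free_monom R a w \<in> carrier (free_algebra R)"
  by (auto simp: free_algebra_simps free_monom_def intro: finite_subset[of _ "{w}"])

text \<open>A nonzero coefficient at w requires a cut of w into pieces from the two supports. The
  support of the product therefore lies among the concatenations of finitely many pairs.\<close>

lemma free_algebra_mult_closed:
  fixes f g :: "'v list \<Rightarrow> 'a"
  assumes "f \<in> carrier (free_algebra R)" "g \<in> carrier (free_algebra R)"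
  shows "f \<otimes>\<^bsub>free_algebra R\<^esub> g \<in> carrier (free_algebra R)"
proof -
  let ?S = "\<lambda>f :: 'v list \<Rightarrow> 'a. {w. f w \<noteq> \<zero>}"
  have "w \<in> (\<lambda>(u, v). u @ v) ` (?S f \<times> ?S g)" if "w \<in> ?S (f \<otimes>\<^bsub>free_algebra R\<^esub> g)" for w
  proof -
    have "\<exists>i\<in>{..length w}. f (take i w) \<otimes> g (drop i w) \<noteq> \<zero>"
    proof (rule ccontr)
      assume "\<not> ?thesis"
      then have "(f \<otimes>\<^bsub>free_algebra R\<^esub> g) w = (\<Oplus>i\<in>{..length w}. \<zero>)"
        unfolding free_algebra_simps by (intro finsum_cong') auto
      with that show False by simp
    qed
    then obtain i where "f (take i w) \<otimes> g (drop i w) \<noteq> \<zero>" ..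
    then have "(take i w, drop i w) \<in> ?S f \<times> ?S g" using assms by (auto simp: free_algebra_closed)
    then show ?thesis by (intro rev_image_eqI) auto
  qed
  then have "?S (f \<otimes>\<^bsub>free_algebra R\<^esub> g) \<subseteq> (\<lambda>(u, v). u @ v) ` (?S f \<times> ?S g)"
    by (rule subsetI)
  moreover have "finite ((\<lambda>(u, v). u @ v) ` (?S f \<times> ?S g))"
    using assms by (simp add: free_algebra_simps)
  ultimately have "finite (?S (f \<otimes>\<^bsub>free_algebra R\<^esub> g))"
    by (rule finite_subset)
  moreover have "(f \<otimes>\<^bsub>free_algebra R\<^esub> g) w \<in> carrier R" for w
    using assms by (simp add: free_algebra_simps)
  ultimately show ?thesis by (simp add: free_algebra_simps(1))
qed

lemma free_algebra_smult_closed: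
  assumes "r \<in> carrier R" "f \<in> carrier (free_algebra R)"
  shows "r \<odot>\<^bsub>free_algebra R\<^esub> f \<in> carrier (free_algebra R)"
  using assms
  by (auto simp: free_algebra_simps intro: finite_subset[of _ "{w. f w \<noteq> \<zero>}"])

lemma ring_free_algebra: "ring (free_algebra R :: ('a, 'v list \<Rightarrow> 'a) module)"
proof (rule ringI)
  show "abelian_group (free_algebra R :: ('a, 'v list \<Rightarrow> 'a) module)"
  proof (rule abelian_groupI)
    fix f g :: "'v list \<Rightarrow> 'a"
    assume fg: "f \<in> carrier (free_algebra R)" "g \<in> carrier (free_algebra R)"
    have "finite {w. f w \<oplus> g w \<noteq> \<zero>}"
      by (rule finite_subset[of _ "{w. f w \<noteq> \<zero>} \<union> {w. g w \<noteq> \<zero>}"])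
        (use fg in \<open>auto simp: free_algebra_simps\<close>)
    with fg show "f \<oplus>\<^bsub>free_algebra R\<^esub> g \<in> carrier (free_algebra R)"
      by (auto simp: free_algebra_simps)
  next
    fix f :: "'v list \<Rightarrow> 'a"
    assume "f \<in> carrier (free_algebra R)"
    then show "\<exists>g\<in>carrier (free_algebra R). g \<oplus>\<^bsub>free_algebra R\<^esub> f = \<zero>\<^bsub>free_algebra R\<^esub>"
      by (intro bexI[of _ "\<lambda>n. \<ominus> f n"])
        (auto simp: free_algebra_simps l_neg intro: finite_subset[of _ "{w. f w \<noteq> \<zero>}"])
  qed (auto simp: free_algebra_simps a_ac)
  show "Group.monoid (free_algebra R :: ('a, 'v list \<Rightarrow> 'a) module)"
  proof (rule monoidI)
    fix f g h :: "'v list \<Rightarrow> 'a"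
    assume [simp]: "f \<in> carrier (free_algebra R)" "g \<in> carrier (free_algebra R)"
      "h \<in> carrier (free_algebra R)"
    note [simp] = free_algebra_closed[of f] free_algebra_closed[of g] free_algebra_closed[of h]
    show "f \<otimes>\<^bsub>free_algebra R\<^esub> g \<in> carrier (free_algebra R)"
      by (simp add: free_algebra_mult_closed)
    show "(f \<otimes>\<^bsub>free_algebra R\<^esub> g) \<otimes>\<^bsub>free_algebra R\<^esub> h = f \<otimes>\<^bsub>free_algebra R\<^esub> (g \<otimes>\<^bsub>free_algebra R\<^esub> h)"
    proof
      fix w :: "'v list"
      let ?n = "length w"
      \<comment> \<open>The word w is cut into consecutive pieces of lengths i, j and l. The
        argument l gives the summand the shape that \<open>finsum_atMost_assoc\<close>
        expects.\<close>
      define e where "e i j l = f (take i w) \<otimes> (g (take j (drop i w)) \<otimes> h (drop (i + j) w))"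
        for i j l :: nat
      have [simp]: "e i j l \<in> carrier R" for i j l by (simp add: e_def)
      have "((f \<otimes>\<^bsub>free_algebra R\<^esub> g) \<otimes>\<^bsub>free_algebra R\<^esub> h) w =
          (\<Oplus>k\<in>{..?n}. \<Oplus>i\<in>{..k}. e i (k - i) (?n - k))"
        unfolding free_algebra_simps
        by (intro finsum_cong')
          (auto simp: e_def finsum_ldistr m_assoc drop_take min_def intro!: finsum_cong' )
      also have "\<dots> = (\<Oplus>i\<in>{..?n}. \<Oplus>j\<in>{..?n - i}. e i j (?n - i - j))"
        by (rule finsum_atMost_assoc[symmetric]) simp
      also have "\<dots> = (f \<otimes>\<^bsub>free_algebra R\<^esub> (g \<otimes>\<^bsub>free_algebra R\<^esub> h)) w"
        unfolding free_algebra_simps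
        by (intro finsum_cong') (auto simp: e_def finsum_rdistr add.commute)
      finally show "((f \<otimes>\<^bsub>free_algebra R\<^esub> g) \<otimes>\<^bsub>free_algebra R\<^esub> h) w =
          (f \<otimes>\<^bsub>free_algebra R\<^esub> (g \<otimes>\<^bsub>free_algebra R\<^esub> h)) w" .
    qed
    show "\<one>\<^bsub>free_algebra R\<^esub> \<otimes>\<^bsub>free_algebra R\<^esub> f = f"
      unfolding free_algebra_simps by (rule ext, subst finsum_atMost_single_left) auto
    show "f \<otimes>\<^bsub>free_algebra R\<^esub> \<one>\<^bsub>free_algebra R\<^esub> = f"
    proof
      fix w :: "'v list"
      \<comment> \<open>Only the cut at the end of w leaves the empty word on the right.\<close>
      have "(f \<otimes>\<^bsub>free_algebra R\<^esub> \<one>\<^bsub>free_algebra R\<^esub>) w =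
          (\<Oplus>i\<in>{..length w}. if length w = i then f (take i w) else \<zero>)"
        unfolding free_algebra_simps by (intro finsum_cong') auto
      also have "\<dots> = f w"
        by (subst finsum_singleton) auto
      finally show "(f \<otimes>\<^bsub>free_algebra R\<^esub> \<one>\<^bsub>free_algebra R\<^esub>) w = f w" .
    qed
  qed (auto simp: free_algebra_one_eq_monom)
qed (auto simp: free_algebra_simps l_distr r_distr finsum_addf Pi_iff)

lemma assoc_algebra_free_algebra: "assoc_algebra R (free_algebra R :: ('a, 'v list \<Rightarrow> 'a) module)"
proof -
  interpret F: ring "free_algebra R :: ('a, 'v list \<Rightarrow> 'a) module" by (rule ring_free_algebra)
  have "module R (free_algebra R :: ('a, 'v list \<Rightarrow> 'a) module)"
    by (rule moduleI)
      (auto simp: is_cring F.abelian_group_axioms free_algebra_smult_closed,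
       auto simp: free_algebra_simps l_distr r_distr m_assoc)
  then show ?thesis
    by (intro assoc_algebra.intro assoc_algebra_axioms.intro F.ring_axioms)
      (auto simp: free_algebra_simps finsum_ldistr finsum_rdistr Pi_iff m_ac)
qed

text \<open>A finitely supported function is the sum of its one-word parts. Zero is covered by the
  monomial case with coefficient zero.\<close>

lemma free_algebra_induct [consumes 1, case_names add monom]:
  assumes f: "f \<in> carrier (free_algebra R)"
    and add: "\<And>f g. f \<in> carrier (free_algebra R) \<Longrightarrow> g \<in> carrier (free_algebra R) \<Longrightarrow>
      P f \<Longrightarrow> P g \<Longrightarrow> P (f \<oplus>\<^bsub>free_algebra R\<^esub> g)"
    and monom: "\<And>a w. a \<in> carrier R \<Longrightarrow> P (free_monom R a w)"
  shows "P f"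
proof -
  \<comment> \<open>S is any finite set containing the support; clearing the coefficient at w brings
    the support into the smaller set.\<close>
  have "P f" if "finite S" "f \<in> carrier (free_algebra R)" "{w. f w \<noteq> \<zero>} \<subseteq> S" for S f
    using that
  proof (induction S arbitrary: f rule: finite_induct)
    case empty
    then have "f = free_monom R \<zero> []" by (auto simp: free_monom_def)
    then show ?case using monom by simp
  next
    case (insert w S)
    note f = \<open>f \<in> carrier (free_algebra R)\<close>
    let ?g = "f(w := \<zero>)"
    have g: "?g \<in> carrier (free_algebra R)"
      using f by (auto simp: free_algebra_simps intro: finite_subset[of _ "{w. f w \<noteq> \<zero>}"])
    have "P ?g" using insert.prems by (intro insert.IH g) auto
    then have "P (?g \<oplus>\<^bsub>free_algebra R\<^esub> free_monom R (f w) w)"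
      using f g monom by (intro add) (auto simp: free_algebra_closed)
    also have "?g \<oplus>\<^bsub>free_algebra R\<^esub> free_monom R (f w) w = f"
      using f by (auto simp: free_algebra_simps free_monom_def fun_eq_iff)
    finally show ?case .
  qed
  from this[OF _ f subset_refl] f show ?thesis by (simp add: free_algebra_simps)
qed

end


section \<open>Quotient algebras\<close>

text \<open>The union over all representatives avoids choosing one. With scalar multiplication for h
  it is the \<open>smult\<close> of \<open>quotient_algebra\<close>.\<close>

definition quotient_map :: "('r, 'm, 'y) module_scheme \<Rightarrow> 'm set \<Rightarrow> ('m \<Rightarrow> 'm) \<Rightarrow> 'm set \<Rightarrow> 'm set" where
  "quotient_map M I h C = (\<Union>f\<in>C. I +>\<^bsub>M\<^esub> h f)"

lemma quotient_algebra_simps: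
  "carrier (quotient_algebra M I) = (\<lambda>a. I +>\<^bsub>M\<^esub> a) ` carrier M"
  "C \<otimes>\<^bsub>quotient_algebra M I\<^esub> C' = rcoset_mult M I C C'"
  "\<one>\<^bsub>quotient_algebra M I\<^esub> = I +>\<^bsub>M\<^esub> \<one>\<^bsub>M\<^esub>"
  "\<zero>\<^bsub>quotient_algebra M I\<^esub> = I"
  "C \<oplus>\<^bsub>quotient_algebra M I\<^esub> C' = C <+>\<^bsub>M\<^esub> C'"
  "r \<odot>\<^bsub>quotient_algebra M I\<^esub> C = quotient_map M I (\<lambda>a. r \<odot>\<^bsub>M\<^esub> a) C"
  by (auto simp: quotient_algebra_def FactRing_simps ring.defs module.defs quotient_map_def)

locale algebra_ideal = assoc_algebra R M + ideal I M for R (structure) and M (structure) and I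
begin

abbreviation "proj a \<equiv> I +>\<^bsub>M\<^esub> a"
abbreviation "Q \<equiv> quotient_algebra M I"

text \<open>The scalar r acts as multiplication by the ring element r 1, so a ring ideal is stable
  under scalars.\<close>

lemma ideal_smult_closed:
  assumes "r \<in> carrier R" "a \<in> I"
  shows "r \<odot>\<^bsub>M\<^esub> a \<in> I"
proof -
  have "r \<odot>\<^bsub>M\<^esub> a = (r \<odot>\<^bsub>M\<^esub> \<one>\<^bsub>M\<^esub>) \<otimes>\<^bsub>M\<^esub> a"
    using assms Icarr by (simp add: smult_mult_left)
  then show ?thesis using assms by (simp add: I_l_closed)
qed

text \<open>Two elements of one coset differ by an element of I, and so do their images under h;
  hence all cosets in the union coincide.\<close>

lemma quotient_map_proj:
  assumes h: "h \<in> carrier M \<rightarrow> carrier M" "h \<in> I \<rightarrow> I"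
    and add: "\<And>a b. a \<in> carrier M \<Longrightarrow> b \<in> carrier M \<Longrightarrow> h (a \<oplus>\<^bsub>M\<^esub> b) = h a \<oplus>\<^bsub>M\<^esub> h b"
    and a: "a \<in> carrier M"
  shows "quotient_map M I h (proj a) = proj (h a)"
proof -
  have "proj (h f) = proj (h a)" if f: "f \<in> proj a" for f
  proof -
    obtain i where i: "i \<in> I" "f = i \<oplus>\<^bsub>M\<^esub> a"
      using f by (auto simp: a_r_coset_def r_coset_def)
    then have "h f = h i \<oplus>\<^bsub>M\<^esub> h a" "h i \<in> I"
      using add h a Icarr by auto
    then have "h f \<in> proj (h a)"
      by (auto simp: a_r_coset_def r_coset_def)
    then show ?thesis
      using h a by (intro a_repr_independence'[symmetric]) (auto intro: a_subgroup)
  qed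
  moreover have "a \<in> proj a" using a by (rule a_rcos_self)
  ultimately show ?thesis unfolding quotient_map_def by blast
qed

lemma quotient_zero: "\<zero>\<^bsub>Q\<^esub> = proj \<zero>\<^bsub>M\<^esub>"
  by (simp add: quotient_algebra_simps a_subset)

lemma proj_closed: "a \<in> carrier M \<Longrightarrow> proj a \<in> carrier Q"
  by (simp add: quotient_algebra_simps)

lemma proj_add:
  "a \<in> carrier M \<Longrightarrow> b \<in> carrier M \<Longrightarrow> proj (a \<oplus>\<^bsub>M\<^esub> b) = proj a \<oplus>\<^bsub>Q\<^esub> proj b"
  by (simp add: quotient_algebra_simps a_rcos_sum)

lemma proj_mult:
  "a \<in> carrier M \<Longrightarrow> b \<in> carrier M \<Longrightarrow> proj (a \<otimes>\<^bsub>M\<^esub> b) = proj a \<otimes>\<^bsub>Q\<^esub> proj b"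
  by (simp add: quotient_algebra_simps rcoset_mult_add)

lemma proj_smult:
  "r \<in> carrier R \<Longrightarrow> a \<in> carrier M \<Longrightarrow> proj (r \<odot>\<^bsub>M\<^esub> a) = r \<odot>\<^bsub>Q\<^esub> proj a"
  by (simp add: quotient_algebra_simps quotient_map_proj ideal_smult_closed smult_r_distr)

lemma assoc_algebra_quotient: "assoc_algebra R Q"
proof -
  interpret Q: ring Q
    unfolding quotient_algebra_def by (intro ring_extend quotient_is_ring)
  have "module R Q"
  proof (intro module.intro module_axioms.intro Q.abelian_group_axioms)
    show "cring R" by (rule R.is_cring)
  \<comment> \<open>Every coset is a projection, so the laws of M carry over by reading
    \<open>proj_add\<close> and \<open>proj_smult\<close> from right to left.\<close>
  qed (auto simp: quotient_algebra_simps(1) simp flip: proj_add proj_smult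
      simp: smult_l_distr smult_r_distr smult_assoc1)
  then show ?thesis
    by (intro assoc_algebra.intro assoc_algebra_axioms.intro Q.ring_axioms)
      (auto simp: quotient_algebra_simps(1) simp flip: proj_mult proj_smult
        simp: smult_mult_left smult_mult_right)
qed

lemma proj_finsum:
  assumes "f \<in> A \<rightarrow> carrier M"
  shows "proj (\<Oplus>\<^bsub>M\<^esub>i\<in>A. f i) = (\<Oplus>\<^bsub>Q\<^esub>i\<in>A. proj (f i))"
proof -
  interpret Q: assoc_algebra R Q by (rule assoc_algebra_quotient)
  show ?thesis
    using assms by (intro finsum_additive)
      (auto simp: proj_closed proj_add M.abelian_monoid_axioms Q.M.abelian_group_axioms)
qed

lemma linear_op_quotient_map:
  assumes h: "linear_op R M h" "h \<in> I \<rightarrow> I"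
  shows "linear_op R Q (quotient_map M I h)"
proof -
  have [simp]: "quotient_map M I h (proj a) = proj (h a)" if "a \<in> carrier M" for a
    using h that by (intro quotient_map_proj) (auto simp: linear_op_def)
  have [simp]: "h a \<in> carrier M" if "a \<in> carrier M" for a
    using h(1) that by (rule linear_op_closed)
  show ?thesis
    using h(1)
    by (auto simp: linear_op_def quotient_algebra_simps(1) simp flip: proj_add proj_smult)
qed

end


section \<open>Weighted maps of the free algebra\<close>

text \<open>This is the operator diagonal on words whose eigenvalue depends on the degree in v. The
  twist arises from c d = k^d, the higher derivation from c d = (d choose i).\<close>

definition free_weight ::
  "('a, 'x) ring_scheme \<Rightarrow> 'v \<Rightarrow> (nat \<Rightarrow> 'a) \<Rightarrow> ('v list \<Rightarrow> 'a) \<Rightarrow> 'v list \<Rightarrow> 'a" where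
  "free_weight R v c f = (\<lambda>w. c (count_list w v) \<otimes>\<^bsub>R\<^esub> f w)"

lemma count_list_take_drop:
  "count_list (take i w) v + count_list (drop i w) v = count_list w v"
  by (metis append_take_drop_id count_list_append)

context cring
begin

lemma linear_op_free_weight:
  fixes v :: 'v
  assumes c: "\<And>d. c d \<in> carrier R"
  shows "linear_op R (free_algebra R) (free_weight R v c)"
  unfolding linear_op_def
proof (intro conjI ballI funcsetI)
  fix f :: "'v list \<Rightarrow> 'a"
  assume f: "f \<in> carrier (free_algebra R)"
  have "finite {w. c (count_list w v) \<otimes> f w \<noteq> \<zero>}"
    by (rule finite_subset[of _ "{w. f w \<noteq> \<zero>}"])
      (use c f in \<open>auto simp: free_algebra_simps\<close>)
  then show "free_weight R v c f \<in> carrier (free_algebra R)"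
    using c f by (auto simp: free_weight_def free_algebra_simps)
qed (use c in \<open>auto simp: free_weight_def free_algebra_simps r_distr m_lcomm\<close>)

lemma free_weight_monom:
  assumes "\<And>d. c d \<in> carrier R"
  shows "free_weight R v c (free_monom R a w) = free_monom R (c (count_list w v) \<otimes> a) w"
  using assms by (auto simp: free_weight_def free_monom_def)

text \<open>Only words beginning with w occur in the product, and counts of v add under
  concatenation, so f meets the weight shifted by the count in w.\<close>

lemma free_weight_monom_mult:
  assumes c: "\<And>d. c d \<in> carrier R" and a: "a \<in> carrier R" and f: "f \<in> carrier (free_algebra R)"
  shows "free_weight R v c (free_monom R a w \<otimes>\<^bsub>free_algebra R\<^esub> f) =
    free_monom R a w \<otimes>\<^bsub>free_algebra R\<^esub> free_weight R v (\<lambda>d. c (count_list w v + d)) f"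
proof
  fix u
  note [simp] = c a free_algebra_closed[OF f]
  have [simp]: "free_monom R a w x \<in> carrier R" for x by (simp add: free_monom_def)
  have "free_weight R v c (free_monom R a w \<otimes>\<^bsub>free_algebra R\<^esub> f) u =
      (\<Oplus>i\<in>{..length u}. c (count_list u v) \<otimes> (free_monom R a w (take i u) \<otimes> f (drop i u)))"
    by (simp add: free_weight_def free_algebra_simps finsum_rdistr Pi_iff)
  also have "\<dots> = (\<Oplus>i\<in>{..length u}. free_monom R a w (take i u) \<otimes>
      (c (count_list w v + count_list (drop i u) v) \<otimes> f (drop i u)))"
  proof (intro finsum_cong' refl)
    fix i
    show "c (count_list u v) \<otimes> (free_monom R a w (take i u) \<otimes> f (drop i u)) =
        free_monom R a w (take i u) \<otimes> (c (count_list w v + count_list (drop i u) v) \<otimes> f (drop i u))"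
      using count_list_take_drop[of i u v] by (auto simp: free_monom_def m_lcomm)
  qed simp
  finally show "free_weight R v c (free_monom R a w \<otimes>\<^bsub>free_algebra R\<^esub> f) u =
      (free_monom R a w \<otimes>\<^bsub>free_algebra R\<^esub> free_weight R v (\<lambda>d. c (count_list w v + d)) f) u"
    by (simp add: free_weight_def free_algebra_simps)
qed

lemma free_weight_mult_monom:
  assumes c: "\<And>d. c d \<in> carrier R" and a: "a \<in> carrier R" and f: "f \<in> carrier (free_algebra R)"
  shows "free_weight R v c (f \<otimes>\<^bsub>free_algebra R\<^esub> free_monom R a w) =
    free_weight R v (\<lambda>d. c (d + count_list w v)) f \<otimes>\<^bsub>free_algebra R\<^esub> free_monom R a w"
proof
  fix u
  note [simp] = c a free_algebra_closed[OF f]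
  have [simp]: "free_monom R a w x \<in> carrier R" for x by (simp add: free_monom_def)
  have "free_weight R v c (f \<otimes>\<^bsub>free_algebra R\<^esub> free_monom R a w) u =
      (\<Oplus>i\<in>{..length u}. c (count_list u v) \<otimes> (f (take i u) \<otimes> free_monom R a w (drop i u)))"
    by (simp add: free_weight_def free_algebra_simps finsum_rdistr Pi_iff)
  also have "\<dots> = (\<Oplus>i\<in>{..length u}. (c (count_list (take i u) v + count_list w v) \<otimes>
      f (take i u)) \<otimes> free_monom R a w (drop i u))"
  proof (intro finsum_cong' refl)
    fix i
    show "c (count_list u v) \<otimes> (f (take i u) \<otimes> free_monom R a w (drop i u)) =
        (c (count_list (take i u) v + count_list w v) \<otimes> f (take i u)) \<otimes> free_monom R a w (drop i u)"
      using count_list_take_drop[of i u v] by (auto simp: free_monom_def m_assoc)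
  qed simp
  finally show "free_weight R v c (f \<otimes>\<^bsub>free_algebra R\<^esub> free_monom R a w) u =
      (free_weight R v (\<lambda>d. c (d + count_list w v)) f \<otimes>\<^bsub>free_algebra R\<^esub> free_monom R a w) u"
    by (simp add: free_weight_def free_algebra_simps)
qed

text \<open>Hence an ideal is preserved by all weighted maps as soon as its generators are mapped into it.\<close>

lemma ideal_free_weight_stable:
  assumes "ideal I (free_algebra R)"
  shows "ideal {f \<in> carrier (free_algebra R). \<forall>c. (\<forall>d. c d \<in> carrier R) \<longrightarrow> free_weight R v c f \<in> I}
    (free_algebra R)" (is "ideal ?J ?F")
proof -
  interpret F: assoc_algebra R ?F by (rule assoc_algebra_free_algebra)
  interpret I: ideal I ?F by fact
  have lin: "linear_op R ?F (free_weight R v c)" if "\<forall>d. c d \<in> carrier R" for c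
    using that by (intro linear_op_free_weight) auto
  note closed = linear_op_closed[OF lin]
  note add = linear_op_add[OF lin]
  have zero: "free_weight R v c \<zero>\<^bsub>?F\<^esub> = \<zero>\<^bsub>?F\<^esub>" if "\<forall>d. c d \<in> carrier R" for c
    using that by (auto simp: free_weight_def free_algebra_simps)
  have uminus: "free_weight R v c (\<ominus>\<^bsub>?F\<^esub> f) = \<ominus>\<^bsub>?F\<^esub> (free_weight R v c f)"
    if "\<forall>d. c d \<in> carrier R" "f \<in> carrier ?F" for c f
    using linear_op_smult[OF lin[OF that(1)], of "\<ominus> \<one>" f] that closed[OF that]
    by (simp add: F.smult_l_minus)
  \<comment> \<open>Multiplication by a word replaces c by a shifted weight. The set
    \<open>?J\<close> survives this because it quantifies over all weights at once.\<close>
  have left: "x \<otimes>\<^bsub>?F\<^esub> f \<in> ?J" if f: "f \<in> ?J" and x: "x \<in> carrier ?F" for x f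
    using x
  proof (induction x rule: free_algebra_induct)
    case (add x y)
    then show ?case
      using f by (auto simp: F.A.l_distr linear_op_add[OF lin])
  next
    case (monom a w)
    then show ?case
      using f by (auto simp: free_weight_monom_mult intro!: I.I_l_closed)
  qed
  have right: "f \<otimes>\<^bsub>?F\<^esub> x \<in> ?J" if f: "f \<in> ?J" and x: "x \<in> carrier ?F" for x f
    using x
  proof (induction x rule: free_algebra_induct)
    case (add x y)
    then show ?case
      using f by (auto simp: F.A.r_distr linear_op_add[OF lin])
  next
    case (monom a w)
    then show ?case
      using f by (auto simp: free_weight_mult_monom intro!: I.I_r_closed)
  qed
  have "subgroup ?J (add_monoid ?F)"
  proof (rule group.subgroupI[OF F.M.a_group])
    have "\<zero>\<^bsub>?F\<^esub> \<in> ?J" using zero by simp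
    then show "?J \<noteq> {}" by blast
  qed (auto simp: uminus add closed simp flip: a_inv_def)
  then show ?thesis
    using left right by (intro idealI F.A.ring_axioms)
qed


subsection \<open>Binomial weights\<close>

text \<open>As a function of d this is the coefficient of t^i in (1 + t)^d, carried into R as a
  multiple of one.\<close>

definition binomial_weight :: "nat \<Rightarrow> nat \<Rightarrow> 'a" where
  "binomial_weight i d = [(d choose i)] \<cdot> \<one>"

lemma binomial_weight_closed [simp]: "binomial_weight i d \<in> carrier R"
  by (simp add: binomial_weight_def)

lemma add_pow_one_mult: "([(m::nat)] \<cdot> \<one>) \<otimes> ([(n::nat)] \<cdot> \<one>) = [(m * n)] \<cdot> \<one>"
  by (simp add: add_pow_ldistr add.nat_pow_pow mult.commute)

lemma add_pow_sum: "x \<in> carrier R \<Longrightarrow> (\<Oplus>i\<in>A. [(f i :: nat)] \<cdot> x) = [(sum f A)] \<cdot> x" if "finite A"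
  using that by (induction A rule: finite_induct) (auto simp: add.nat_pow_mult)

lemma binomial_weight_vandermonde:
  "(\<Oplus>i\<in>{..n}. binomial_weight i a \<otimes> binomial_weight (n - i) b) = binomial_weight n (a + b)"
  by (simp add: binomial_weight_def add_pow_one_mult add_pow_sum vandermonde)

text \<open>This is the binomial theorem for k = 1 + (k - 1). The bound N may exceed d because the
  additional binomial coefficients vanish; thus one range of summation serves all words of an
  element.\<close>

lemma nat_pow_eq_binomial_sum:
  assumes k: "k \<in> carrier R" and "d \<le> N"
  shows "(\<Oplus>i\<in>{..N}. (k \<ominus> \<one>) [^] i \<otimes> binomial_weight i d) = k [^] d"
  using \<open>d \<le> N\<close>
proof (induction d arbitrary: N)
  case 0
  have "(\<Oplus>i\<in>{..N}. (k \<ominus> \<one>) [^] i \<otimes> binomial_weight i 0) = (k \<ominus> \<one>) [^] (0::nat) \<otimes> binomial_weight 0 0"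
    using k by (intro finsum_atMost_single_left) (auto simp: binomial_weight_def binomial_eq_0)
  then show ?case by (simp add: binomial_weight_def)
next
  case (Suc d)
  then obtain M where N: "N = Suc M" and "d \<le> M" by (cases N) auto
  let ?t = "k \<ominus> \<one>"
  let ?b = binomial_weight
  have [simp]: "?t \<in> carrier R" using k by simp
  have pascal: "?b (Suc i) (Suc d) = ?b i d \<oplus> ?b (Suc i) d" for i
    by (simp add: binomial_weight_def add.nat_pow_mult)
  have "(\<Oplus>i\<in>{..N}. ?t [^] i \<otimes> ?b i (Suc d)) =
      (\<Oplus>i\<in>{..M}. ?t [^] Suc i \<otimes> (?b i d \<oplus> ?b (Suc i) d)) \<oplus> ?t [^] (0::nat) \<otimes> ?b 0 (Suc d)"
    unfolding N by (subst finsum_Suc2) (simp_all only: pascal, auto)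
  \<comment> \<open>Of the two parts given by Pascal's rule, the first is \<open>?t\<close> times
    the sum for d up to M. The second, joined with the term at 0, is the sum for d up to N. The
    induction hypothesis covers both bounds.\<close>
  also have "\<dots> = (\<Oplus>i\<in>{..M}. ?t \<otimes> (?t [^] i \<otimes> ?b i d)) \<oplus>
      ((\<Oplus>i\<in>{..M}. ?t [^] Suc i \<otimes> ?b (Suc i) d) \<oplus> ?t [^] (0::nat) \<otimes> ?b 0 d)"
    by (simp add: r_distr finsum_addf Pi_iff m_ac a_assoc) (simp add: binomial_weight_def)
  also have "(\<Oplus>i\<in>{..M}. ?t [^] Suc i \<otimes> ?b (Suc i) d) \<oplus> ?t [^] (0::nat) \<otimes> ?b 0 d =
      (\<Oplus>i\<in>{..N}. ?t [^] i \<otimes> ?b i d)"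
    unfolding N by (subst finsum_Suc2) auto
  also have "(\<Oplus>i\<in>{..M}. ?t \<otimes> (?t [^] i \<otimes> ?b i d)) = ?t \<otimes> (\<Oplus>i\<in>{..M}. ?t [^] i \<otimes> ?b i d)"
    by (rule finsum_rdistr[symmetric]) auto
  also have "\<dots> \<oplus> (\<Oplus>i\<in>{..N}. ?t [^] i \<otimes> ?b i d) = ?t \<otimes> k [^] d \<oplus> k [^] d"
    using Suc.IH[of M] Suc.IH[of N] \<open>d \<le> M\<close> N by simp
  also have "\<dots> = k [^] Suc d"
  proof -
    have "k [^] Suc d = k \<otimes> k [^] d" using k by (simp add: m_comm)
    also have "\<dots> = ?t \<otimes> k [^] d \<oplus> k [^] d"
      using k by (simp add: minus_eq l_distr l_minus a_assoc l_neg)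
    finally show ?thesis by simp
  qed
  finally show ?case .
qed

lemma free_algebra_finsum:
  fixes h :: "'i \<Rightarrow> 'v list \<Rightarrow> 'a"
  assumes "h \<in> A \<rightarrow> carrier (free_algebra R)"
  shows "(\<Oplus>\<^bsub>free_algebra R\<^esub>i\<in>A. h i) w = (\<Oplus>i\<in>A. h i w)"
proof -
  interpret F: assoc_algebra R "free_algebra R :: ('a, 'v list \<Rightarrow> 'a) module"
    by (rule assoc_algebra_free_algebra)
  show ?thesis
    using assms by (intro finsum_additive[of "free_algebra R" R "\<lambda>f. f w"])
      (auto simp: free_algebra_closed F.M.abelian_monoid_axioms abelian_group_axioms free_algebra_simps(5))
qed

text \<open>For each cut of a word the counts of v in the two pieces add up, so Vandermonde's
  identity splits the weight of the word. The sums over cuts and over i are then exchanged.\<close>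

lemma free_weight_binomial_mult:
  fixes f g :: "'v list \<Rightarrow> 'a"
  assumes f: "f \<in> carrier (free_algebra R)" and g: "g \<in> carrier (free_algebra R)"
  shows "free_weight R v (binomial_weight n) (f \<otimes>\<^bsub>free_algebra R\<^esub> g) =
    (\<Oplus>\<^bsub>free_algebra R\<^esub>i\<in>{..n}. free_weight R v (binomial_weight i) f
      \<otimes>\<^bsub>free_algebra R\<^esub> free_weight R v (binomial_weight (n - i)) g)"
proof
  fix w
  note [simp] = free_algebra_closed[OF f] free_algebra_closed[OF g]
  let ?b = binomial_weight
  let ?c = "\<lambda>w. count_list w v"
  have split: "?b n (?c w) \<otimes> (f (take j w) \<otimes> g (drop j w)) =
      (\<Oplus>i\<in>{..n}. (?b i (?c (take j w)) \<otimes> f (take j w)) \<otimes> (?b (n - i) (?c (drop j w)) \<otimes> g (drop j w)))"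
    for j
  proof -
    have "?b n (?c w) \<otimes> (f (take j w) \<otimes> g (drop j w)) =
        (\<Oplus>i\<in>{..n}. (?b i (?c (take j w)) \<otimes> ?b (n - i) (?c (drop j w))) \<otimes> (f (take j w) \<otimes> g (drop j w)))"
      by (simp add: binomial_weight_vandermonde count_list_take_drop Pi_iff flip: finsum_ldistr)
    then show ?thesis by (simp add: m_ac)
  qed
  have "free_weight R v (?b n) (f \<otimes>\<^bsub>free_algebra R\<^esub> g) w =
      (\<Oplus>j\<in>{..length w}. \<Oplus>i\<in>{..n}. (?b i (?c (take j w)) \<otimes> f (take j w))
        \<otimes> (?b (n - i) (?c (drop j w)) \<otimes> g (drop j w)))"
    unfolding free_weight_def free_algebra_simps
    by (simp add: finsum_rdistr Pi_iff split)
  also have "\<dots> = (\<Oplus>i\<in>{..n}. \<Oplus>j\<in>{..length w}. (?b i (?c (take j w)) \<otimes> f (take j w))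
        \<otimes> (?b (n - i) (?c (drop j w)) \<otimes> g (drop j w)))"
    by (rule finsum_swap) auto
  also have "\<dots> = (\<Oplus>i\<in>{..n}. (free_weight R v (?b i) f
      \<otimes>\<^bsub>free_algebra R\<^esub> free_weight R v (?b (n - i)) g) w)"
    by (simp add: free_weight_def free_algebra_simps)
  also have "\<dots> = (\<Oplus>\<^bsub>free_algebra R\<^esub>i\<in>{..n}. free_weight R v (?b i) f
      \<otimes>\<^bsub>free_algebra R\<^esub> free_weight R v (?b (n - i)) g) w"
    using f g
    by (intro free_algebra_finsum[symmetric])
      (auto intro!: free_algebra_mult_closed linear_op_closed[OF linear_op_free_weight])
  finally show "free_weight R v (?b n) (f \<otimes>\<^bsub>free_algebra R\<^esub> g) w =
      (\<Oplus>\<^bsub>free_algebra R\<^esub>i\<in>{..n}. free_weight R v (?b i) f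
        \<otimes>\<^bsub>free_algebra R\<^esub> free_weight R v (?b (n - i)) g) w" .
qed

end


section \<open>The quantum plane\<close>

text \<open>Only the cut after \<open>length u\<close> letters can contribute; the case split deals
  with words too short to have that cut.\<close>

lemma (in cring) free_monom_mult:
  assumes "a \<in> carrier R" "b \<in> carrier R"
  shows "free_monom R a u \<otimes>\<^bsub>free_algebra R\<^esub> free_monom R b v = free_monom R (a \<otimes> b) (u @ v)"
proof
  fix w
  have "(free_monom R a u \<otimes>\<^bsub>free_algebra R\<^esub> free_monom R b v) w =
      (\<Oplus>i\<in>{..length w}. if length u = i then (if w = u @ v then a \<otimes> b else \<zero>) else \<zero>)"
    unfolding free_algebra_simps
  proof (intro finsum_cong' refl)
    fix i assume "i \<in> {..length w}"
    then show "free_monom R a u (take i w) \<otimes> free_monom R b v (drop i w) =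
        (if length u = i then (if w = u @ v then a \<otimes> b else \<zero>) else \<zero>)"
      using assms append_take_drop_id[of i w] by (auto simp: free_monom_def)
  qed (use assms in auto)
  also have "\<dots> = free_monom R (a \<otimes> b) (u @ v) w"
  proof (cases "length u \<le> length w")
    case True
    then show ?thesis
      using assms by (subst finsum_singleton) (auto simp: free_monom_def)
  next
    case False
    then have "(\<Oplus>i\<in>{..length w}. if length u = i then (if w = u @ v then a \<otimes> b else \<zero>) else \<zero>) =
        (\<Oplus>i\<in>{..length w}. \<zero>)"
      by (intro finsum_cong') auto
    then show ?thesis using False by (auto simp: free_monom_def)
  qed
  finally show "(free_monom R a u \<otimes>\<^bsub>free_algebra R\<^esub> free_monom R b v) w =
      free_monom R (a \<otimes> b) (u @ v) w" .
qed

lemma (in cring) free_monom_smult: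
  "r \<in> carrier R \<Longrightarrow> r \<odot>\<^bsub>free_algebra R\<^esub> free_monom R a w = free_monom R (r \<otimes> a) w"
  by (auto simp: free_algebra_simps free_monom_def)

locale quantum_plane = cring R for R (structure) and q +
  assumes q_closed [simp]: "q \<in> carrier R"
begin

abbreviation "F \<equiv> free_algebra R :: ('a, letter list \<Rightarrow> 'a) module"
abbreviation "qrel \<equiv> (free_gen R X \<otimes>\<^bsub>F\<^esub> free_gen R Y) \<ominus>\<^bsub>F\<^esub> (q \<odot>\<^bsub>F\<^esub> (free_gen R Y \<otimes>\<^bsub>F\<^esub> free_gen R X))"

lemma qplane_ideal_eq: "qplane_ideal R q = Idl\<^bsub>F\<^esub> {qrel}"
  by (simp add: qplane_ideal_def Let_def)

lemma qrel_eq: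
  "qrel = free_monom R \<one> [X, Y] \<ominus>\<^bsub>F\<^esub> free_monom R q [Y, X]"
  by (simp add: free_gen_eq_monom free_monom_mult free_monom_smult)

end

sublocale quantum_plane \<subseteq> F: algebra_ideal R F "qplane_ideal R q"
proof -
  interpret F: assoc_algebra R F by (rule assoc_algebra_free_algebra)
  have "ideal (qplane_ideal R q) F"
    unfolding qplane_ideal_eq qrel_eq by (rule F.A.genideal_ideal) (simp add: F.M.minus_closed)
  then show "algebra_ideal R F (qplane_ideal R q)"
    by (intro algebra_ideal.intro F.assoc_algebra_axioms)
qed

sublocale quantum_plane \<subseteq> Q: assoc_algebra R "qplane R q"
  unfolding qplane_def by (rule F.assoc_algebra_quotient)

section \<open>Weighted maps on the quantum plane\<close>

context quantum_plane
begin

lemmas proj = F.proj_add[folded qplane_def] F.proj_mult[folded qplane_def]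
  F.proj_smult[folded qplane_def]

text \<open>Both words of the relation contain exactly one letter Y, so a weighted map multiplies
  \<open>qrel\<close> by c 1. The elements that all weighted maps send into the ideal form an ideal
  themselves, and it contains the generator.\<close>

lemma free_weight_ideal:
  assumes "\<And>d. c d \<in> carrier R"
  shows "free_weight R Y c \<in> qplane_ideal R q \<rightarrow> qplane_ideal R q"
proof -
  let ?J = "{f \<in> carrier F. \<forall>c. (\<forall>d. c d \<in> carrier R) \<longrightarrow> free_weight R Y c f \<in> qplane_ideal R q}"
  have qrel: "qrel \<in> carrier F" unfolding qrel_eq by (simp add: F.M.minus_closed)
  then have mem: "qrel \<in> qplane_ideal R q"
    unfolding qplane_ideal_eq by (rule F.A.genideal_self')
  have "free_weight R Y c qrel = c 1 \<odot>\<^bsub>F\<^esub> qrel" if "\<forall>d. c d \<in> carrier R" for c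
  proof -
    have c [simp]: "c d \<in> carrier R" for d using that by blast
    note lin = linear_op_free_weight[of c Y, OF c]
    have minus: "x \<ominus>\<^bsub>F\<^esub> y = x \<oplus>\<^bsub>F\<^esub> (\<ominus> \<one>) \<odot>\<^bsub>F\<^esub> y" if "y \<in> carrier F" for x y
      using that by (simp add: F.M.minus_eq F.smult_l_minus)
    show ?thesis
      unfolding qrel_eq
      by (simp add: minus linear_op_add[OF lin] linear_op_smult[OF lin] free_weight_monom
          F.smult_r_distr free_monom_smult m_ac)
  qed
  with mem qrel have "qrel \<in> ?J"
    by (auto intro: F.ideal_smult_closed)
  moreover have "ideal ?J F"
    by (rule ideal_free_weight_stable) (rule F.ideal_axioms)
  ultimately have "qplane_ideal R q \<subseteq> ?J"
    unfolding qplane_ideal_eq by (intro F.A.genideal_minimal) auto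
  then show ?thesis using assms by auto
qed

definition qplane_weight :: "(nat \<Rightarrow> 'a) \<Rightarrow> (letter list \<Rightarrow> 'a) set \<Rightarrow> (letter list \<Rightarrow> 'a) set" where
  "qplane_weight c = quotient_map F (qplane_ideal R q) (free_weight R Y c)"

lemma linear_op_qplane_weight:
  "(\<And>d. c d \<in> carrier R) \<Longrightarrow> linear_op R (qplane R q) (qplane_weight c)"
  unfolding qplane_weight_def qplane_def
  by (intro F.linear_op_quotient_map linear_op_free_weight free_weight_ideal)

lemma qplane_weight_proj:
  assumes "\<And>d. c d \<in> carrier R" "f \<in> carrier F"
  shows "qplane_weight c (F.proj f) = F.proj (free_weight R Y c f)"
  using linear_op_free_weight[of c Y, OF assms(1)] assms
  unfolding qplane_weight_def
  by (intro F.quotient_map_proj free_weight_ideal) (auto simp: linear_op_def)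

section \<open>Words and their normal ordering\<close>

definition word :: "letter list \<Rightarrow> (letter list \<Rightarrow> 'a) set" where
  "word w = F.proj (free_monom R \<one> w)"

lemma proj_closed: "f \<in> carrier F \<Longrightarrow> F.proj f \<in> carrier (qplane R q)"
  by (simp add: qplane_def F.proj_closed)

lemma word_closed [simp]: "word w \<in> carrier (qplane R q)"
  by (simp add: word_def proj_closed)

lemma word_append: "word (u @ v) = word u \<otimes>\<^bsub>qplane R q\<^esub> word v"
  by (simp add: word_def free_monom_mult flip: proj)

lemma word_Nil: "word [] = \<one>\<^bsub>qplane R q\<^esub>"
  by (simp add: word_def qplane_def quotient_algebra_simps free_algebra_one_eq_monom)

lemma proj_monom: "a \<in> carrier R \<Longrightarrow> F.proj (free_monom R a w) = a \<odot>\<^bsub>qplane R q\<^esub> word w"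
  by (simp add: word_def free_monom_smult flip: proj)

lemma qplane_gen_pow: "qplane_gen R q v [^]\<^bsub>qplane R q\<^esub> (n::nat) = word (replicate n v)"
proof (induction n)
  case (Suc n)
  have "word (replicate (Suc n) v) = word (replicate n v @ [v])"
    by (simp add: replicate_append_same)
  moreover have "qplane_gen R q v = word [v]"
    by (simp add: qplane_gen_def free_gen_eq_monom word_def)
  ultimately show ?case
    using Suc by (simp add: word_append)
qed (simp add: word_Nil)

lemma qplane_monom_eq_word: "qplane_monom R q m n = word (replicate m Y @ replicate n X)"
  by (simp add: qplane_monom_def qplane_gen_pow word_append)

lemma word_XY: "word [X, Y] = q \<odot>\<^bsub>qplane R q\<^esub> word [Y, X]"
proof -
  have "qrel \<in> qplane_ideal R q"
    unfolding qplane_ideal_eq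
    by (rule F.A.genideal_self') (simp add: qrel_eq F.M.minus_closed)
  then have "F.proj (free_monom R \<one> [X, Y]) = F.proj (free_monom R q [Y, X])"
    unfolding qrel_eq by (subst F.quotient_eq_iff_same_a_r_cos[symmetric]) (auto simp: F.ideal_axioms)
  then show ?thesis by (simp add: word_def free_monom_smult flip: proj)
qed

text \<open>Each letter Y that X passes contributes one factor q, by \<open>word_XY\<close>.\<close>

lemma word_X_replicate_Y:
  "word (X # replicate m Y @ v) = (q [^] m) \<odot>\<^bsub>qplane R q\<^esub> word (replicate m Y @ X # v)"
proof (induction m)
  case (Suc m)
  have "word (X # replicate (Suc m) Y @ v) = word [X, Y] \<otimes>\<^bsub>qplane R q\<^esub> word (replicate m Y @ v)"
    by (simp flip: word_append)
  also have "\<dots> = q \<odot>\<^bsub>qplane R q\<^esub> (word [Y] \<otimes>\<^bsub>qplane R q\<^esub> word (X # replicate m Y @ v))"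
    by (simp add: word_XY Q.smult_mult_left flip: word_append)
  also have "\<dots> = q \<odot>\<^bsub>qplane R q\<^esub> (q [^] m \<odot>\<^bsub>qplane R q\<^esub> word (replicate (Suc m) Y @ X # v))"
    by (simp add: Suc Q.smult_mult_right flip: word_append)
  also have "\<dots> = q [^] Suc m \<odot>\<^bsub>qplane R q\<^esub> word (replicate (Suc m) Y @ X # v)"
    by (simp add: m_comm flip: Q.smult_assoc1)
  finally show ?case .
qed simp

text \<open>Normal ordering proceeds from the right end of the word: a new letter Y raises m by one,
  a new letter X crosses all m letters Y at the cost of q^m. Hence the ordered monomials
  span.\<close>

lemma word_eq_smult_monom:
  "\<exists>a\<in>carrier R. \<exists>m n. word w = a \<odot>\<^bsub>qplane R q\<^esub> qplane_monom R q m n"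
proof (induction w)
  case Nil
  have "word [] = \<one> \<odot>\<^bsub>qplane R q\<^esub> qplane_monom R q 0 0"
    by (simp add: qplane_monom_eq_word)
  then show ?case by blast
next
  case (Cons l w)
  then obtain a m n where a: "a \<in> carrier R" and w: "word w = a \<odot>\<^bsub>qplane R q\<^esub> qplane_monom R q m n"
    by blast
  have lw: "word (l # w) = a \<odot>\<^bsub>qplane R q\<^esub> word (l # replicate m Y @ replicate n X)"
    using a w word_append[of "[l]" w] word_append[of "[l]" "replicate m Y @ replicate n X"]
    by (simp add: Q.smult_mult_right qplane_monom_eq_word)
  show ?case
  proof (cases l)
    case X
    have "word (l # w) = (a \<otimes> q [^] m) \<odot>\<^bsub>qplane R q\<^esub> qplane_monom R q m (Suc n)"
      unfolding lw unfolding X word_X_replicate_Y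
      using a by (simp add: qplane_monom_eq_word Q.smult_assoc1)
    then show ?thesis
      by (intro bexI[of _ "a \<otimes> q [^] m"] exI) (use a in simp_all)
  next
    case Y
    have "word (l # w) = a \<odot>\<^bsub>qplane R q\<^esub> qplane_monom R q (Suc m) n"
      unfolding lw unfolding Y by (simp add: qplane_monom_eq_word)
    then show ?thesis
      by (intro bexI[of _ a] exI) (use a in simp_all)
  qed
qed

lemma qplane_carrier: "carrier (qplane R q) = F.proj ` carrier F"
  by (simp add: qplane_def quotient_algebra_simps)

text \<open>Every word is a multiple of an ordered monomial, so agreement on these monomials spreads
  to all elements. This supplies the uniqueness in the definition of
  \<open>qplane_twist\<close>.\<close>

lemma linear_op_eq_on_monoms:
  assumes f: "linear_op R (qplane R q) f" and g: "linear_op R (qplane R q) g"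
    and eq: "\<And>m n. f (qplane_monom R q m n) = g (qplane_monom R q m n)"
    and C: "C \<in> carrier (qplane R q)"
  shows "f C = g C"
proof -
  obtain h where "C = F.proj h" and h: "h \<in> carrier F"
    using C by (auto simp: qplane_carrier)
  have "f (F.proj h) = g (F.proj h)"
    using h
  proof (induction h rule: free_algebra_induct)
    case (add h h')
    then show ?case
      by (simp add: proj proj_closed linear_op_add[OF f] linear_op_add[OF g])
  next
    case (monom a w)
    obtain b m n where b: "b \<in> carrier R" and w: "word w = b \<odot>\<^bsub>qplane R q\<^esub> qplane_monom R q m n"
      using word_eq_smult_monom by blast
    have [simp]: "qplane_monom R q m n \<in> carrier (qplane R q)"
      by (simp add: qplane_monom_eq_word)
    show ?case
      using monom b
      by (simp add: proj_monom w linear_op_smult[OF f] linear_op_smult[OF g] eq)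
  qed
  with \<open>C = F.proj h\<close> show ?thesis by simp
qed

section \<open>The twist as a weighted map\<close>

lemma qplane_weight_monom:
  assumes "\<And>d. c d \<in> carrier R"
  shows "qplane_weight c (qplane_monom R q m n) = c m \<odot>\<^bsub>qplane R q\<^esub> qplane_monom R q m n"
proof -
  have "count_list (replicate m Y) Y = m" by (induction m) auto
  then show ?thesis
    using assms by (simp add: qplane_monom_eq_word word_def[of "_ @ _"] qplane_weight_proj free_weight_monom
        free_monom_smult flip: proj)
qed

text \<open>The description defining \<open>qplane_twist\<close> has the restricted weighted map as
  a solution, and \<open>linear_op_eq_on_monoms\<close> makes it the only one. The restriction
  supplies extensionality, so the comparison with the unrestricted map is made on the
  carrier.\<close>

lemma qplane_twist_eq:
  assumes k: "k \<in> carrier R" and C: "C \<in> carrier (qplane R q)"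
  shows "qplane_twist R q k C = qplane_weight (\<lambda>d. k [^] d) C"
proof -
  let ?w = "qplane_weight (\<lambda>d. k [^] d)"
  let ?g = "restrict ?w (carrier (qplane R q))"
  have w: "linear_op R (qplane R q) ?w"
    using k by (intro linear_op_qplane_weight) simp
  have monom: "qplane_monom R q m n \<in> carrier (qplane R q)" for m n
    by (simp add: qplane_monom_eq_word)
  have w_monom: "?w (qplane_monom R q m n) = (k [^] m) \<odot>\<^bsub>qplane R q\<^esub> qplane_monom R q m n" for m n
    using k by (intro qplane_weight_monom) simp
  have "qplane_twist R q k = ?g"
    unfolding qplane_twist_def
  proof (rule the_equality)
    have "linear_op R (qplane R q) ?g"
      using w by (auto simp: linear_op_def)
    then show "?g \<in> extensional (carrier (qplane R q)) \<and> linear_op R (qplane R q) ?g \<and>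
        (\<forall>m n. ?g (qplane_monom R q m n) = (k [^] m) \<odot>\<^bsub>qplane R q\<^esub> qplane_monom R q m n)"
      by (simp add: monom w_monom)
  next
    fix f
    assume f: "f \<in> extensional (carrier (qplane R q)) \<and> linear_op R (qplane R q) f \<and>
        (\<forall>m n. f (qplane_monom R q m n) = (k [^] m) \<odot>\<^bsub>qplane R q\<^esub> qplane_monom R q m n)"
    then have "f C = ?g C" if "C \<in> carrier (qplane R q)" for C
      using linear_op_eq_on_monoms[of f ?w C] w w_monom that by simp
    with f show "f = ?g" by (auto intro: extensionalityI)
  qed
  then show ?thesis using C by simp
qed

section \<open>The higher derivation and its value at t = k - 1\<close>

lemma qplane_weight_binomial_zero:
  assumes "C \<in> carrier (qplane R q)"
  shows "qplane_weight (binomial_weight 0) C = C"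
proof -
  obtain f where f: "C = F.proj f" "f \<in> carrier F" using assms by (auto simp: qplane_carrier)
  then have "free_weight R Y (binomial_weight 0) f = f"
    by (simp add: free_weight_def binomial_weight_def free_algebra_closed)
  with f show ?thesis by (simp add: qplane_weight_proj)
qed

lemma qplane_weight_binomial_mult:
  assumes "C \<in> carrier (qplane R q)" "C' \<in> carrier (qplane R q)"
  shows "qplane_weight (binomial_weight n) (C \<otimes>\<^bsub>qplane R q\<^esub> C') =
    (\<Oplus>\<^bsub>qplane R q\<^esub>i\<in>{..n}. qplane_weight (binomial_weight i) C
      \<otimes>\<^bsub>qplane R q\<^esub> qplane_weight (binomial_weight (n - i)) C')"
proof -
  obtain f g where C: "C = F.proj f" "C' = F.proj g" and f: "f \<in> carrier F" and g: "g \<in> carrier F"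
    using assms by (auto simp: qplane_carrier)
  have [simp]: "free_weight R Y (binomial_weight i) f \<in> carrier F"
    "free_weight R Y (binomial_weight i) g \<in> carrier F" for i
    using f g by (auto intro!: linear_op_closed[OF linear_op_free_weight])
  show ?thesis
    using f g
    by (simp add: C qplane_weight_proj free_weight_binomial_mult Pi_iff
        F.proj_finsum[folded qplane_def] flip: proj)
qed

text \<open>A representative involves finitely many words, so its degree in Y is bounded and only
  finitely many coefficients survive. On each word the binomial theorem sums the weights to a power
  of k.\<close>

lemma qplane_twist_poly_value:
  assumes k: "k \<in> carrier R" and C: "C \<in> carrier (qplane R q)"
  shows "poly_value R (qplane R q) (k \<ominus> \<one>) (\<lambda>i. qplane_weight (binomial_weight i) C)
    (qplane_twist R q k C)"
proof -
  let ?t = "k \<ominus> \<one>"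
  let ?D = "\<lambda>i. qplane_weight (binomial_weight i) C"
  have t [simp]: "?t \<in> carrier R" using k by simp
  obtain f where Cf: "C = F.proj f" and f: "f \<in> carrier F" using C by (auto simp: qplane_carrier)
  \<comment> \<open>For f = 0 this is \<open>Max\<close> of the empty set and N is unspecified. That
    is harmless, since the bound is invoked only at words with nonzero coefficient.\<close>
  define N where "N = Max ((\<lambda>w. count_list w Y) ` {w. f w \<noteq> \<zero>})"
  have N: "count_list w Y \<le> N" if "f w \<noteq> \<zero>" for w
    using f that unfolding N_def by (intro Max_ge) (auto simp: free_algebra_simps)
  have D_closed [simp]: "?D i \<in> carrier (qplane R q)" for i
    using C by (intro linear_op_closed[OF linear_op_qplane_weight]) auto
  have fw [simp]: "free_weight R Y (binomial_weight i) f \<in> carrier F" for i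
    using f by (auto intro!: linear_op_closed[OF linear_op_free_weight])
  have "?D i = \<zero>\<^bsub>qplane R q\<^esub>" if "N < i" for i
  proof -
    have "binomial_weight i (count_list w Y) \<otimes> f w = \<zero>" for w
    proof (cases "f w = \<zero>")
      case False
      with N[OF this] \<open>N < i\<close> show ?thesis
        using free_algebra_closed[OF f] by (simp add: binomial_weight_def binomial_eq_0)
    qed simp
    then have "free_weight R Y (binomial_weight i) f = \<zero>\<^bsub>F\<^esub>"
      by (simp add: free_weight_def free_algebra_simps)
    then show ?thesis
      using f by (simp add: Cf qplane_weight_proj qplane_def F.quotient_zero)
  qed
  then have supp: "{i. ?D i \<noteq> \<zero>\<^bsub>qplane R q\<^esub>} \<subseteq> {..N}" by (auto simp: not_less[symmetric])
  have "(\<Oplus>\<^bsub>qplane R q\<^esub>i\<in>{i. ?D i \<noteq> \<zero>\<^bsub>qplane R q\<^esub>}. (?t [^] i) \<odot>\<^bsub>qplane R q\<^esub> ?D i) =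
      (\<Oplus>\<^bsub>qplane R q\<^esub>i\<in>{..N}. (?t [^] i) \<odot>\<^bsub>qplane R q\<^esub> ?D i)"
    using supp by (intro Q.M.add.finprod_mono_neutral_cong_left) auto
  also have "\<dots> = (\<Oplus>\<^bsub>qplane R q\<^esub>i\<in>{..N}. F.proj ((?t [^] i) \<odot>\<^bsub>F\<^esub> free_weight R Y (binomial_weight i) f))"
    using f by (simp add: Cf qplane_weight_proj proj)
  also have "\<dots> = F.proj (\<Oplus>\<^bsub>F\<^esub>i\<in>{..N}. (?t [^] i) \<odot>\<^bsub>F\<^esub> free_weight R Y (binomial_weight i) f)"
    by (simp add: F.proj_finsum[folded qplane_def] Pi_iff)
  \<comment> \<open>The representatives themselves agree, so the comparison can be made coefficient
    by coefficient in the free algebra.\<close>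
  also have "(\<Oplus>\<^bsub>F\<^esub>i\<in>{..N}. (?t [^] i) \<odot>\<^bsub>F\<^esub> free_weight R Y (binomial_weight i) f) =
      free_weight R Y (\<lambda>d. k [^] d) f"
  proof
    fix w
    have fw': "f w \<in> carrier R" by (rule free_algebra_closed[OF f])
    have "(\<Oplus>\<^bsub>F\<^esub>i\<in>{..N}. (?t [^] i) \<odot>\<^bsub>F\<^esub> free_weight R Y (binomial_weight i) f) w =
        (\<Oplus>i\<in>{..N}. ((?t [^] i) \<odot>\<^bsub>F\<^esub> free_weight R Y (binomial_weight i) f) w)"
      by (rule free_algebra_finsum) (auto intro!: F.smult_closed)
    also have "\<dots> = (\<Oplus>i\<in>{..N}. ?t [^] i \<otimes> binomial_weight i (count_list w Y) \<otimes> f w)"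
      using fw' by (simp add: free_algebra_simps free_weight_def m_assoc)
    also have "\<dots> = (\<Oplus>i\<in>{..N}. ?t [^] i \<otimes> binomial_weight i (count_list w Y)) \<otimes> f w"
      using fw' by (intro finsum_ldistr[symmetric]) auto
    also have "\<dots> = free_weight R Y (\<lambda>d. k [^] d) f w"
    proof (cases "f w = \<zero>")
      case True
      then show ?thesis using k by (simp add: free_weight_def)
    next
      case False
      then show ?thesis
        by (simp only: free_weight_def nat_pow_eq_binomial_sum[OF k N[OF False]])
    qed
    finally show "(\<Oplus>\<^bsub>F\<^esub>i\<in>{..N}. (?t [^] i) \<odot>\<^bsub>F\<^esub> free_weight R Y (binomial_weight i) f) w =
        free_weight R Y (\<lambda>d. k [^] d) f w" .
  qed
  also have "F.proj (free_weight R Y (\<lambda>d. k [^] d) f) = qplane_twist R q k C"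
    using k C f by (simp add: qplane_twist_eq Cf qplane_weight_proj)
  finally show ?thesis
    using finite_subset[OF supp] by (simp add: poly_value_def)
qed

end

theorem proposition4:
  fixes K (structure) and q :: 'a
  assumes "field K"
    and char_0: "\<And>n::nat. n > 0 \<Longrightarrow> [n] \<cdot> \<one> \<noteq> \<zero>"
    and "q \<in> Units K"
  shows "family_is_formal_deformation K (qplane K q) (Units K) \<one>
    (qplane_hom_mult K q) (qplane_twist K q)
    (\<lambda>a b. a \<otimes>\<^bsub>qplane K q\<^esub> b) (\<lambda>a. a)"
proof -
  interpret field K by fact
  interpret quantum_plane K q using assms(3) by unfold_locales auto
  \<comment> \<open>These are the Taylor coefficients of the twist at k = 1: expanding k^d in powers
    of k - 1 produces the binomial weights.\<close>
  let ?D = "\<lambda>i. qplane_weight (binomial_weight i)"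
  have "formal_hom_assoc_deformation K (qplane K q) (\<lambda>a b. a \<otimes>\<^bsub>qplane K q\<^esub> b) (\<lambda>a. a)
      (\<lambda>i a b. ?D i (a \<otimes>\<^bsub>qplane K q\<^esub> b)) ?D"
    by (intro Q.formal_hom_assoc_deformation_higher_derivation linear_op_qplane_weight
        qplane_weight_binomial_zero qplane_weight_binomial_mult) auto
  \<comment> \<open>The product at k is the twist at k applied to a b, so the value of its
    polynomial is that of the twist at the element a b.\<close>
  then show ?thesis
    unfolding family_is_formal_deformation_def qplane_hom_mult_def
    by (intro exI[of _ "\<lambda>i a b. ?D i (a \<otimes>\<^bsub>qplane K q\<^esub> b)"] exI[of _ ?D] conjI ballI
        qplane_twist_poly_value) auto
qed

end
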